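(* Assume that either the Markov chain is stationary, i.e. $\pi P=\pi$, or $P$ admits a faithful stationary probability vector $\pi_+$ (i.e. $\pi_+P=\pi_+$ and $\pi_{+\omega}>0$ for all $\omega\in\Omega$). Then for every $X\in\mathfrak{A}$ the limit $$ \bar X(\boldsymbol\omega)=\lim_{N\to\infty}\frac1N\sum_{n=0}^{N-1}\mathcal{L}^*_{\omega_1}\cdots\mathcal{L}^*_{\omega_n}X(\omega_{n+1}) $$ exists for $\mathbb{P}$-almost every $\boldsymbol\omega$ and in $L^1(\boldsymbol\Omega,\mathbb{P};\mathcal{B}(\mathcal{H}))$. The limiting function satisfies, $\mathbb{P}$-almost surely, $$ \mathcal{L}^*_{\omega_1}\bar X(\phi(\boldsymbol\omega))=\bar X(\boldsymbol\omega). $$ Moreover, the element $\bar{\bar X}\in\mathfrak{A}$ defined by $\bar{\bar X}(\omega)=\mathbb{E}[\bar X(\boldsymbol\omega)\,|\,\omega_1=\omega]$ satisfies $\mathbb{L}^*\bar{\bar X}=\bar{\bar X}$.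
   Context: Setting. $\Omega$ is a finite nonempty set, $\mathcal{H}$ a finite-dimensional nonzero complex Hilbert space, $\pi$ a probability vector on $\Omega$, $P=(P_{\omega\nu})$ a right stochastic $\Omega\times\Omega$ matrix, and $(\mathcal{L}_\omega)_{\omega\in\Omega}$ a family of completely positive trace-preserving (CPTP) maps on $\mathcal{B}(\mathcal{H})$. $\mathcal{L}_\omega^*$ is the adjoint of $\mathcal{L}_\omega$ for the pairing $\langle\alpha,A\rangle=\mathrm{tr}(\alpha^*A)$. $\mathfrak{A}$ is the algebra of all functions $X:\Omega\to\mathcal{B}(\mathcal{H})$ (pointwise operations). $\boldsymbol\Omega=\Omega^{\mathbb{N}}$ ($\mathbb N=\{0,1,2,\dots\}$) with its product $\sigma$-algebra; $\boldsymbol\omega=(\omega_0,\omega_1,\dots)$; $\phi$ is the left shift. $\mathbb{P}$ is the Markov measure with $\mathbb{P}(\{\boldsymbol\omega:\omega_0=\nu_0,\dots,\omega_n=\nu_n\})=\pi_{\nu_0}P_{\nu_0\nu_1}\cdots P_{\nu_{n-1}\nu_n}$, and $\mathbb{E}$ its expectation. $\mathbb{L}$ acts on functions $R:\Omega\to\mathcal{B}(\mathcal{H})$ by $(\mathbb{L}R)(\omega)=\sum_{\nu\in\Omega}P_{\nu\omega}\mathcal{L}_\nu R(\nu)$; its adjoint for the pairing $\langle R,X\rangle=\sum_\omega\mathrm{tr}(R(\omega)^*X(\omega))$ is $(\mathbb{L}^*X)(\omega)=\sum_{\nu\in\Omega}P_{\omega\nu}\mathcal{L}_\omega^*X(\nu)$.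 The function $\bar X$ depends only on $(\omega_1,\omega_2,\dots)$ (set it to $0$ where the limit does not exist); the conditional expectation given $\omega_1=\omega$ is the expectation with respect to the Markov chain $(\omega_1,\omega_2,\dots)$ with transition matrix $P$ started at $\omega_1=\omega$ (when $\mathbb{P}(\omega_1=\omega)>0$ this is the usual elementary conditional expectation). *)

theory Defs
  imports "HOL-Probability.Probability"
begin

text \<open>
  The finite nonempty set is a type \<open>'w::finite\<close>.  A nonzero finite-dimensional complex Hilbert
  space is, after the choice of an orthonormal basis, \<open>complex^'n\<close> with \<open>'n::finite\<close>, and its
  bounded operators are the matrices \<open>complex^'n^'n\<close>.  The norm on matrices is that of the type
  \<open>complex^'n^'n\<close> (the Hilbert--Schmidt norm); in finite dimension it is equivalent to the operator
  norm, so convergence, integrability and \<open>L\<^sup>1\<close> convergence are the same for both.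
\<close>

subsection \<open>Completely positive trace-preserving maps\<close>

type_synonym 'n op = "complex^'n^'n"

definition cscale :: "complex \<Rightarrow> ('n::finite) op \<Rightarrow> 'n op" where
  "cscale c = map_matrix ((*) c)"

definition dagger :: "('n::finite) op \<Rightarrow> 'n op" where
  "dagger A = (\<chi> i j. cnj (A $ j $ i))"

definition cinner :: "complex^('n::finite) \<Rightarrow> complex^'n \<Rightarrow> complex" where
  "cinner u v = (\<Sum>i\<in>UNIV. cnj (u $ i) * v $ i)"

definition hs_inner :: "('n::finite) op \<Rightarrow> 'n op \<Rightarrow> complex" where
  "hs_inner \<alpha> A = trace (dagger \<alpha> ** A)"

abbreviation clinear_map :: "(('n::finite) op \<Rightarrow> 'n op) \<Rightarrow> bool" where
  "clinear_map \<equiv> Vector_Spaces.linear cscale cscale"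

text \<open>
  The family \<open>A i j\<close> with \<open>i, j < k\<close> is the element of \<open>\<B>(\<H>) \<otimes> M\<^sub>k\<close> with these operator blocks;
  it acts on \<open>\<H> \<otimes> \<complex>\<^sup>k\<close>, whose elements are the families \<open>v i\<close> with \<open>i < k\<close>.  Over the complex
  numbers, a quadratic form with nonnegative values already makes the operator Hermitian.
\<close>

definition block_positive :: "nat \<Rightarrow> (nat \<Rightarrow> nat \<Rightarrow> ('n::finite) op) \<Rightarrow> bool" where
  "block_positive k A \<longleftrightarrow>
     (\<forall>v. (\<Sum>i<k. \<Sum>j<k. cinner (v i) (A i j *v v j)) \<in> \<real>\<^sub>\<ge>\<^sub>0)"

definition completely_positive :: "(('n::finite) op \<Rightarrow> 'n op) \<Rightarrow> bool" where
  "completely_positive \<Phi> \<longleftrightarrow>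
     clinear_map \<Phi> \<and> (\<forall>k A. block_positive k A \<longrightarrow> block_positive k (\<lambda>i j. \<Phi> (A i j)))"

definition cptp :: "(('n::finite) op \<Rightarrow> 'n op) \<Rightarrow> bool" where
  "cptp \<Phi> \<longleftrightarrow> completely_positive \<Phi> \<and> (\<forall>A. trace (\<Phi> A) = trace A)"

definition hs_adjoint :: "(('n::finite) op \<Rightarrow> 'n op) \<Rightarrow> 'n op \<Rightarrow> 'n op" where
  "hs_adjoint \<Phi> = (THE \<Psi>. \<forall>\<alpha> A. hs_inner (\<Phi> \<alpha>) A = hs_inner \<alpha> (\<Psi> A))"

lemma vector_space_cscale: "vector_space (cscale :: complex \<Rightarrow> ('n::finite) op \<Rightarrow> 'n op)"
  by unfold_locales (simp_all add: cscale_def vec_eq_iff algebra_simps)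

lemma hs_inner_eq: "hs_inner A B = (\<Sum>i\<in>UNIV. \<Sum>j\<in>UNIV. cnj (A $ i $ j) * B $ i $ j)"
proof -
  have "hs_inner A B = (\<Sum>j\<in>UNIV. \<Sum>i\<in>UNIV. cnj (A $ i $ j) * B $ i $ j)"
    by (simp add: hs_inner_def trace_def dagger_def matrix_matrix_mult_def)
  then show ?thesis by (subst sum.swap)
qed

lemma Re_hs_inner: "Re (hs_inner A B) = A \<bullet> B"
  by (simp add: hs_inner_eq inner_vec_def inner_complex_def)

lemma Im_hs_inner: "Im (hs_inner A B) = cscale \<i> A \<bullet> B"
  by (simp add: hs_inner_eq inner_vec_def inner_complex_def cscale_def algebra_simps)

lemma cscale_sum_scaleR: "cscale c (\<Sum>i\<in>I. r i *\<^sub>R f i) = (\<Sum>i\<in>I. r i *\<^sub>R cscale c (f i))"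
  by (simp add: cscale_def vec_eq_iff sum_distrib_left mult.left_commute flip: scaleR_conv_of_real)

lemma hs_inner_adjoint:
  assumes "clinear_map \<Phi>"
  shows "hs_inner (\<Phi> \<alpha>) A = hs_inner \<alpha> (hs_adjoint \<Phi> A)"
proof -
  have add: "\<Phi> (x + y) = \<Phi> x + \<Phi> y" and scale: "\<Phi> (cscale c x) = cscale c (\<Phi> x)" for c x y
    using assms by (simp_all add: Vector_Spaces.linear_iff)
  have "cscale (of_real r) x = r *\<^sub>R x" for r and x :: "'a op"
    by (simp add: cscale_def vec_eq_iff complex_eq_iff)
  then have lin: "linear \<Phi>"
    using add scale by (metis linearI)
  have ex: "\<forall>\<alpha> A. hs_inner (\<Phi> \<alpha>) A = hs_inner \<alpha> (adjoint \<Phi> A)"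
    by (simp add: complex_eq_iff Re_hs_inner Im_hs_inner adjoint_works[OF lin] flip: scale)
  moreover have "\<Psi> = adjoint \<Phi>" if "\<forall>\<alpha> A. hs_inner (\<Phi> \<alpha>) A = hs_inner \<alpha> (\<Psi> A)" for \<Psi>
  proof
    fix A
    have "\<alpha> \<bullet> \<Psi> A = \<alpha> \<bullet> adjoint \<Phi> A" for \<alpha>
      using that ex by (metis Re_hs_inner)
    then show "\<Psi> A = adjoint \<Phi> A" by (metis vector_eq_ldot)
  qed
  ultimately have "\<forall>\<alpha> A. hs_inner (\<Phi> \<alpha>) A = hs_inner \<alpha> (hs_adjoint \<Phi> A)"
    unfolding hs_adjoint_def by (rule theI)
  then show ?thesis by blast
qed


subsection \<open>Markov chains\<close>

definition prob_vector :: "real^('w::finite) \<Rightarrow> bool" where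
  "prob_vector p \<longleftrightarrow> (\<forall>w. 0 \<le> p $ w) \<and> (\<Sum>w\<in>UNIV. p $ w) = 1"

definition right_stochastic :: "real^'w^('w::finite) \<Rightarrow> bool" where
  "right_stochastic P \<longleftrightarrow> (\<forall>w. prob_vector (P $ w))"

abbreviation path_space :: "(nat \<Rightarrow> 'w) measure" where
  "path_space \<equiv> Pi\<^sub>M UNIV (\<lambda>_. count_space UNIV)"

definition is_markov_measure ::
    "real^('w::finite) \<Rightarrow> real^'w^'w \<Rightarrow> (nat \<Rightarrow> 'w) measure \<Rightarrow> bool" where
  "is_markov_measure p P M \<longleftrightarrow>
     prob_space M \<and> sets M = sets path_space \<and>
     (\<forall>n \<nu>. measure M {\<omega>. \<forall>i\<le>n. \<omega> i = \<nu> i} = p $ \<nu> 0 * (\<Prod>i<n. P $ \<nu> i $ \<nu> (Suc i)))"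

definition markov_measure :: "real^('w::finite) \<Rightarrow> real^'w^'w \<Rightarrow> (nat \<Rightarrow> 'w) measure" where
  "markov_measure p P = (THE M. is_markov_measure p P M)"

definition left_shift :: "(nat \<Rightarrow> 'w) \<Rightarrow> nat \<Rightarrow> 'w" where
  "left_shift \<omega> = (\<lambda>n. \<omega> (Suc n))"

lemma cylinder_sets: "{\<omega>. \<forall>i\<le>n. \<omega> i = \<nu> i} \<in> sets (path_space :: (nat \<Rightarrow> 'w::finite) measure)"
proof -
  have "{\<omega> \<in> space path_space. \<forall>i\<in>{..n}. \<omega> i = \<nu> i}
      \<in> sets (path_space :: (nat \<Rightarrow> 'w::finite) measure)"
    by measurable
  moreover have "{\<omega> \<in> space path_space. \<forall>i\<in>{..n}. \<omega> i = \<nu> i} = {\<omega>. \<forall>i\<le>n. \<omega> i = \<nu> i}"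
    by (auto simp: space_PiM)
  ultimately show ?thesis by simp
qed

lemma is_markov_measure_unique:
  fixes M N :: "(nat \<Rightarrow> 'w::finite) measure"
  assumes M: "is_markov_measure p P M" and N: "is_markov_measure p P N"
  shows "M = N"
proof (rule measure_eqI_PiM_infinite)
  show sM[simp]: "sets M = sets path_space" and sN[simp]: "sets N = sets path_space"
    using M N by (auto simp: is_markov_measure_def)
  have pM: "prob_space M" and pN: "prob_space N"
    using M N by (auto simp: is_markov_measure_def)
  interpret M: prob_space M by fact
  interpret N: prob_space N by fact
  show "finite_measure M" by (rule M.finite_measure_axioms)
  fix A :: "nat \<Rightarrow> 'w set" and J :: "nat set"
  assume J: "finite J"
  then obtain n where n: "J \<subseteq> {..n}" using finite_nat_iff_bounded_le by blast
  let ?E = "prod_emb UNIV (\<lambda>_. count_space UNIV) J (Pi\<^sub>E J A)"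
  let ?C = "\<lambda>\<nu>::nat \<Rightarrow> 'w. {\<omega>. \<forall>i\<le>n. \<omega> i = \<nu> i}"
  let ?S = "{\<nu> \<in> Pi\<^sub>E {..n} (\<lambda>_. UNIV). \<forall>i\<in>J. \<nu> i \<in> A i}"
  have fin: "finite ?S"
    by (rule finite_subset[of _ "Pi\<^sub>E {..n} (\<lambda>_. UNIV)"]) (auto intro!: finite_PiE)
  have E: "?E = (\<Union>\<nu>\<in>?S. ?C \<nu>)"
  proof (intro set_eqI iffI)
    fix \<omega> assume "\<omega> \<in> ?E"
    then have "\<forall>i\<in>J. \<omega> i \<in> A i" by (auto simp: prod_emb_def)
    then have "restrict \<omega> {..n} \<in> ?S" "\<omega> \<in> ?C (restrict \<omega> {..n})"
      using n by auto
    then show "\<omega> \<in> (\<Union>\<nu>\<in>?S. ?C \<nu>)" by blast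
  next
    fix \<omega> assume "\<omega> \<in> (\<Union>\<nu>\<in>?S. ?C \<nu>)"
    then show "\<omega> \<in> ?E" using n by (fastforce simp: prod_emb_def)
  qed
  have disj: "disjoint_family_on ?C ?S"
    unfolding disjoint_family_on_def
  proof (intro ballI impI)
    fix \<nu> \<mu> assume "\<nu> \<in> ?S" "\<mu> \<in> ?S" and ne: "\<nu> \<noteq> \<mu>"
    then have "\<nu> \<in> Pi\<^sub>E {..n} (\<lambda>_. UNIV)" "\<mu> \<in> Pi\<^sub>E {..n} (\<lambda>_. UNIV)" by simp_all
    from PiE_ext[OF this] ne obtain i where i: "i \<le> n" "\<nu> i \<noteq> \<mu> i" by blast
    show "?C \<nu> \<inter> ?C \<mu> = {}"
    proof (rule equals0I)
      fix \<omega> assume "\<omega> \<in> ?C \<nu> \<inter> ?C \<mu>"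
      then have "\<omega> i = \<nu> i" "\<omega> i = \<mu> i" using i(1) by blast+
      with i(2) show False by simp
    qed
  qed
  have "measure M ?E = (\<Sum>\<nu>\<in>?S. measure M (?C \<nu>))"
    unfolding E by (rule M.finite_measure_finite_Union[OF fin _ disj]) (auto simp: cylinder_sets)
  also have "\<dots> = (\<Sum>\<nu>\<in>?S. measure N (?C \<nu>))"
    using M N by (simp add: is_markov_measure_def)
  also have "\<dots> = measure N ?E"
    unfolding E by (rule N.finite_measure_finite_Union[OF fin _ disj, symmetric]) (auto simp: cylinder_sets)
  finally show "emeasure M ?E = emeasure N ?E"
    by (simp add: M.emeasure_eq_measure N.emeasure_eq_measure)
qed

text \<open>
  Existence: at every time \<open>Suc n\<close> and for every state \<open>w\<close> draw an independent successor of \<open>w\<close>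
  from the row \<open>P $ w\<close>, and let the path follow these draws.
\<close>

lemma pmf_of_prob_vector:
  assumes "prob_vector p"
  obtains q where "\<And>w. pmf q w = p $ w"
proof
  have "(\<integral>\<^sup>+w. ennreal (p $ w) \<partial>count_space UNIV) = 1"
    using assms by (simp add: nn_integral_count_space_finite prob_vector_def)
  then show "pmf (embed_pmf (\<lambda>w. p $ w)) w = p $ w" for w
    using assms by (subst pmf_embed_pmf) (auto simp: prob_vector_def)
qed

primrec follow :: "(nat \<times> 'w \<Rightarrow> 'w) \<Rightarrow> nat \<Rightarrow> 'w" where
  "follow \<xi> 0 = \<xi> (0, undefined)"
| "follow \<xi> (Suc n) = \<xi> (Suc n, follow \<xi> n)"

lemma is_markov_measure_exists:
  fixes p :: "real^'w::finite"
  assumes p: "prob_vector p" and P: "right_stochastic P"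
  shows "\<exists>M. is_markov_measure p P M"
proof -
  obtain q0 where q0: "pmf q0 w = p $ w" for w
    using pmf_of_prob_vector[OF p] by blast
  have "\<exists>q. \<forall>v. pmf q v = P $ w $ v" for w
    using P pmf_of_prob_vector[of "P $ w"] unfolding right_stochastic_def by metis
  then obtain q where q: "pmf (q w) v = P $ w $ v" for w v
    by metis
  define K :: "nat \<times> 'w \<Rightarrow> 'w measure"
    where "K = (\<lambda>(n, w). measure_pmf (if n = 0 then q0 else q w))"
  interpret K: product_prob_space K UNIV
    by (rule product_prob_spaceI) (auto simp: K_def prob_space_measure_pmf split: prod.split)
  have spK[simp]: "space (K i) = UNIV" and setsK[simp]: "sets (K i) = UNIV" for i
    by (simp_all add: K_def split: prod.split)
  have meas_n: "(\<lambda>\<xi>. follow \<xi> n) \<in> Pi\<^sub>M UNIV K \<rightarrow>\<^sub>M count_space UNIV" for n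
  proof (induction n)
    case 0
    have "(\<lambda>\<xi>. \<xi> (0, undefined)) \<in> Pi\<^sub>M UNIV K \<rightarrow>\<^sub>M K (0, undefined)"
      by (rule measurable_component_singleton) simp
    moreover have "measurable (Pi\<^sub>M UNIV K) (K (0, undefined)) = measurable (Pi\<^sub>M UNIV K) (count_space UNIV)"
      by (rule measurable_cong_sets) simp_all
    ultimately show ?case by simp
  next
    case (Suc n)
    have "(\<lambda>\<xi>. \<xi> (Suc n, w)) \<in> Pi\<^sub>M UNIV K \<rightarrow>\<^sub>M count_space UNIV" for w
    proof -
      have "(\<lambda>\<xi>. \<xi> (Suc n, w)) \<in> Pi\<^sub>M UNIV K \<rightarrow>\<^sub>M K (Suc n, w)"
        by (rule measurable_component_singleton) simp
      moreover have "measurable (Pi\<^sub>M UNIV K) (K (Suc n, w)) = measurable (Pi\<^sub>M UNIV K) (count_space UNIV)"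
        by (rule measurable_cong_sets) simp_all
      ultimately show ?thesis by simp
    qed
    then have "(\<lambda>\<xi>. (\<lambda>w \<xi>. \<xi> (Suc n, w)) (follow \<xi> n) \<xi>) \<in> Pi\<^sub>M UNIV K \<rightarrow>\<^sub>M count_space UNIV"
      by (rule measurable_compose_countable[OF _ Suc])
    then show ?case by (simp only: follow.simps)
  qed
  have meas: "follow \<in> Pi\<^sub>M UNIV K \<rightarrow>\<^sub>M path_space"
    by (rule measurable_PiM_single') (auto simp: meas_n)
  define M where "M = distr (Pi\<^sub>M UNIV K) path_space follow"
  have "measure M {\<omega>. \<forall>i\<le>n. \<omega> i = \<nu> i} = p $ \<nu> 0 * (\<Prod>i<n. P $ \<nu> i $ \<nu> (Suc i))" for n \<nu>
  proof -
    define g where "g = (\<lambda>i. case i of 0 \<Rightarrow> (0, undefined) | Suc m \<Rightarrow> (Suc m, \<nu> m))"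
    have g[simp]: "g 0 = (0, undefined)" "g (Suc m) = (Suc m, \<nu> m)" for m
      by (simp_all add: g_def)
    have fg: "fst (g i) = i" for i by (cases i) simp_all
    then have inj: "inj_on g {..n}" by (metis inj_onI)
    have path: "(\<forall>i\<le>n. follow \<xi> i = \<nu> i) \<longleftrightarrow> (\<forall>i\<le>n. \<xi> (g i) = \<nu> i)" for \<xi>
    proof (induction n)
      case (Suc n)
      have "(\<forall>i\<le>Suc n. follow \<xi> i = \<nu> i) \<longleftrightarrow> (\<forall>i\<le>n. follow \<xi> i = \<nu> i) \<and> \<xi> (Suc n, follow \<xi> n) = \<nu> (Suc n)"
        by (auto simp: le_Suc_eq)
      also have "\<dots> \<longleftrightarrow> (\<forall>i\<le>n. follow \<xi> i = \<nu> i) \<and> \<xi> (Suc n, \<nu> n) = \<nu> (Suc n)"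
        by auto
      also have "\<dots> \<longleftrightarrow> (\<forall>i\<le>Suc n. \<xi> (g i) = \<nu> i)"
        unfolding Suc by (auto simp: le_Suc_eq)
      finally show ?case .
    qed simp
    have emb: "\<xi> \<in> prod_emb UNIV K (g ` {..n}) (Pi\<^sub>E (g ` {..n}) (\<lambda>j. {\<nu> (fst j)}))
        \<longleftrightarrow> (\<forall>i\<le>n. follow \<xi> i = \<nu> i)" for \<xi>
    proof -
      have "\<xi> \<in> prod_emb UNIV K (g ` {..n}) (Pi\<^sub>E (g ` {..n}) (\<lambda>j. {\<nu> (fst j)}))
          \<longleftrightarrow> (\<forall>j\<in>g ` {..n}. \<xi> j = \<nu> (fst j))"
        unfolding prod_emb_def by (simp add: restrict_PiE_iff Pi_iff del: split_paired_All)
      also have "\<dots> \<longleftrightarrow> (\<forall>i\<le>n. follow \<xi> i = \<nu> i)"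
        unfolding path by (simp add: fg Ball_def[of "{..n}"] del: split_paired_All)
      finally show ?thesis .
    qed
    have eq: "follow -` {\<omega>. \<forall>i\<le>n. \<omega> i = \<nu> i} \<inter> space (Pi\<^sub>M UNIV K)
        = prod_emb UNIV K (g ` {..n}) (Pi\<^sub>E (g ` {..n}) (\<lambda>j. {\<nu> (fst j)}))"
      by (intro set_eqI) (simp only: emb, simp add: space_PiM)
    have "measure M {\<omega>. \<forall>i\<le>n. \<omega> i = \<nu> i}
        = measure (Pi\<^sub>M UNIV K) (prod_emb UNIV K (g ` {..n}) (Pi\<^sub>E (g ` {..n}) (\<lambda>j. {\<nu> (fst j)})))"
      unfolding M_def by (subst measure_distr[OF meas cylinder_sets]) (simp only: eq)
    also have "\<dots> = (\<Prod>j\<in>g ` {..n}. measure (K j) {\<nu> (fst j)})"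
      by (rule K.measure_PiM_emb) simp_all
    also have "\<dots> = (\<Prod>i\<le>n. measure (K (g i)) {\<nu> i})"
      by (simp add: prod.reindex[OF inj] fg)
    also have "\<dots> = measure (K (g 0)) {\<nu> 0} * (\<Prod>i<n. measure (K (g (Suc i))) {\<nu> (Suc i)})"
      by (rule prod.atMost_shift)
    also have "\<dots> = p $ \<nu> 0 * (\<Prod>i<n. P $ \<nu> i $ \<nu> (Suc i))"
      by (simp add: K_def measure_pmf_single q0 q)
    finally show ?thesis .
  qed
  moreover have "prob_space M"
    unfolding M_def by (rule K.prob_space_distr[OF meas])
  ultimately have "is_markov_measure p P M"
    by (simp add: is_markov_measure_def M_def)
  then show ?thesis ..
qed

lemma is_markov_measure_markov_measure:
  assumes "prob_vector p" "right_stochastic P"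
  shows "is_markov_measure p P (markov_measure p P)"
  unfolding markov_measure_def
  using is_markov_measure_exists[OF assms] is_markov_measure_unique by (metis the_equality)


subsection \<open>Ergodic averages\<close>

text \<open>The element \<open>\<L>\<^sup>*\<^bsub>\<omega> 1\<^esub> \<cdots> \<L>\<^sup>*\<^bsub>\<omega> n\<^esub> X (\<omega> (n + 1))\<close>; for \<open>n = 0\<close> it is \<open>X (\<omega> 1)\<close>.\<close>

definition heisenberg_product ::
    "('w \<Rightarrow> ('n::finite) op \<Rightarrow> 'n op) \<Rightarrow> ('w \<Rightarrow> 'n op) \<Rightarrow> nat \<Rightarrow> (nat \<Rightarrow> 'w) \<Rightarrow> 'n op" where
  "heisenberg_product L X n \<omega> = foldr (\<lambda>k A. hs_adjoint (L (\<omega> k)) A) [1..<Suc n] (X (\<omega> (Suc n)))"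

definition ergodic_average ::
    "('w \<Rightarrow> ('n::finite) op \<Rightarrow> 'n op) \<Rightarrow> ('w \<Rightarrow> 'n op) \<Rightarrow> nat \<Rightarrow> (nat \<Rightarrow> 'w) \<Rightarrow> 'n op" where
  "ergodic_average L X N \<omega> = (1 / real N) *\<^sub>R (\<Sum>n<N. heisenberg_product L X n \<omega>)"

definition Xbar ::
    "('w \<Rightarrow> ('n::finite) op \<Rightarrow> 'n op) \<Rightarrow> ('w \<Rightarrow> 'n op) \<Rightarrow> (nat \<Rightarrow> 'w) \<Rightarrow> 'n op" where
  "Xbar L X \<omega> =
     (if convergent (\<lambda>N. ergodic_average L X N \<omega>) then lim (\<lambda>N. ergodic_average L X N \<omega>) else 0)"

text \<open>
  The conditional expectation of \<^const>\<open>Xbar\<close> given \<open>\<omega> 1 = w\<close>: here \<open>\<xi>\<close> is the chain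
  \<open>(\<omega> 1, \<omega> 2, \<dots>)\<close> started at \<open>w\<close> (\<open>axis w 1\<close> is the unit mass at \<open>w\<close>).  As \<^const>\<open>Xbar\<close> does not
  depend on \<open>\<omega> 0\<close>, the value \<open>w\<close> put there by \<open>case_nat\<close> is a mere filler.
\<close>

definition Xbarbar ::
    "real^'w^('w::finite) \<Rightarrow> ('w \<Rightarrow> ('n::finite) op \<Rightarrow> 'n op) \<Rightarrow> ('w \<Rightarrow> 'n op) \<Rightarrow> 'w \<Rightarrow> 'n op" where
  "Xbarbar P L X w = (\<integral>\<xi>. Xbar L X (case_nat w \<xi>) \<partial>markov_measure (axis w 1) P)"

definition markov_transfer ::
    "real^'w^('w::finite) \<Rightarrow> ('w \<Rightarrow> ('n::finite) op \<Rightarrow> 'n op) \<Rightarrow> ('w \<Rightarrow> 'n op) \<Rightarrow> 'w \<Rightarrow> 'n op" where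
  "markov_transfer P L R = (\<lambda>w. \<Sum>\<nu>\<in>UNIV. (P $ \<nu> $ w) *\<^sub>R L \<nu> (R \<nu>))"

definition markov_transfer_adjoint ::
    "real^'w^('w::finite) \<Rightarrow> ('w \<Rightarrow> ('n::finite) op \<Rightarrow> 'n op) \<Rightarrow> ('w \<Rightarrow> 'n op) \<Rightarrow> 'w \<Rightarrow> 'n op" where
  "markov_transfer_adjoint P L X = (\<lambda>w. \<Sum>\<nu>\<in>UNIV. (P $ w $ \<nu>) *\<^sub>R hs_adjoint (L w) (X \<nu>))"

lemma Xbar_shift_indep:
  assumes "left_shift \<omega> = left_shift \<omega>'"
  shows "Xbar L X \<omega> = Xbar L X \<omega>'"
proof -
  have *: "\<omega> (Suc k) = \<omega>' (Suc k)" for k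
    using assms by (metis left_shift_def)
  have "\<omega> k = \<omega>' k" if "k \<in> set [1..<Suc n]" for k n
  proof -
    have "1 \<le> k" using that by (simp only: set_upt atLeastLessThan_iff)
    then show ?thesis using *[of "k - 1"] by simp
  qed
  then have "heisenberg_product L X n \<omega> = heisenberg_product L X n \<omega>'" for n
    unfolding heisenberg_product_def * by (intro foldr_cong) (simp_all del: upt_Suc set_upt)
  then show ?thesis by (simp add: Xbar_def ergodic_average_def)
qed

lemma markov_transfer_adjoint_pairing:
  assumes "\<And>w. clinear_map (L w)"
  shows "(\<Sum>w\<in>UNIV. hs_inner (markov_transfer P L R w) (X w))
       = (\<Sum>w\<in>UNIV. hs_inner (R w) (markov_transfer_adjoint P L X w))"
proof -
  have left: "hs_inner (\<Sum>\<nu>\<in>UNIV. a \<nu> *\<^sub>R f \<nu>) B = (\<Sum>\<nu>\<in>UNIV. a \<nu> *\<^sub>R hs_inner (f \<nu>) B)"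
    and right: "hs_inner B (\<Sum>\<nu>\<in>UNIV. a \<nu> *\<^sub>R f \<nu>) = (\<Sum>\<nu>\<in>UNIV. a \<nu> *\<^sub>R hs_inner B (f \<nu>))"
    for a :: "'a \<Rightarrow> real" and f :: "'a \<Rightarrow> 'b op" and B
    by (simp_all add: complex_eq_iff Re_hs_inner Im_hs_inner inner_sum_left inner_sum_right
        cscale_sum_scaleR)
  show ?thesis
    unfolding markov_transfer_def markov_transfer_adjoint_def left right hs_inner_adjoint[OF assms]
    by (rule sum.swap)
qed

end

theory Submission
  imports Defs
begin

text \<open>
  Write \<open>T\<^sub>w\<close> for the adjoint of \<open>L w\<close>, \<open>K\<close> for the adjoint transfer operator and \<open>Q\<^sub>n X\<close> for the random
  product \<open>T\<^bsub>\<xi> 0\<^esub> \<cdots> T\<^bsub>\<xi> (n-1)\<^esub> X (\<xi> n)\<close> along a chain \<open>\<xi>\<close>.  The Markov property says that the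
  conditional expectation of \<open>Q\<^sub>n X\<close> given \<open>\<xi> 0, \<dots>, \<xi> (n-1)\<close> is \<open>Q\<^bsub>n-1\<^esub> (K X)\<close>.  Since \<open>K\<close> is power
  bounded on a finite-dimensional space, \<open>X = Y + (Z - K Z)\<close> with \<open>K Y = Y\<close>.  Then \<open>Q\<^sub>n Y\<close> is a bounded
  martingale, hence converges almost surely, while the sums of \<open>Q\<^sub>n (Z - K Z)\<close> are, up to a bounded
  telescoping error, sums of the bounded martingale differences \<open>Q\<^sub>n Z - Q\<^bsub>n-1\<^esub> (K Z)\<close>, so their
  averages tend to \<open>0\<close>.  The average of \<open>Q\<^sub>n X\<close> for the chain started at \<open>w\<close> has expectation
  \<open>(1/N) \<Sum>\<^sub>n (K\<^sup>n X) w\<close>, whose limit is fixed by \<open>K\<close>.  The chain that matters is the shifted one,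
  with initial distribution \<open>\<pi> P\<close>.
\<close>

section \<open>Splitting under power-bounded maps, and Cesaro means\<close>

section \<open>Decomposition and averaging lemmas\<close>

text \<open>For \<open>g = id - f\<close>, boundedness of the powers forces the kernel and the range
  of \<open>g\<close> to meet only in 0. Hence \<open>g\<close> is injective on its range and, by
  dimension, maps it onto itself, so \<open>g x = g (g z)\<close> for some \<open>z\<close>, and
  \<open>x - g z\<close> is fixed by \<open>f\<close>.\<close>

lemma fixed_plus_coboundary:
  fixes f :: "'a::euclidean_space \<Rightarrow> 'a"
  assumes f: "linear f" and bounded: "\<And>x. Bseq (\<lambda>n. (f ^^ n) x)"
  obtains y z where "f y = y" "x = y + (z - f z)"
proof -
  define g where "g = (\<lambda>x. x - f x)"
  have g: "linear g"
    unfolding g_def by (intro linear_compose_sub linear_ident f)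
  have eq_0: "y = 0" if y: "y = g z" "g y = 0" for y z
  proof -
    have fy: "f y = y" and fz: "f z = z - y" using y by (simp_all add: g_def)
    \<comment> \<open>A fixed vector \<open>y = g z\<close> makes the iterates of \<open>z\<close>
      drift linearly, which boundedness allows only for \<open>y = 0\<close>.\<close>
    have iter: "(f ^^ n) z = z - real n *\<^sub>R y" for n
    proof (induction n)
      case (Suc n)
      have "(f ^^ Suc n) z = f z - real n *\<^sub>R f y"
        using Suc by (simp add: linear_diff[OF f] linear_cmul[OF f])
      then show ?case unfolding fy fz by (simp add: algebra_simps)
    qed simp
    obtain c where c: "norm ((f ^^ n) z) \<le> c" for n
      using bounded[of z] by (auto simp: Bseq_def)
    have "real n * norm y \<le> c + norm z" for n
    proof -
      have "real n * norm y = norm (z - (f ^^ n) z)" by (simp add: iter)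
      also have "\<dots> \<le> norm z + norm ((f ^^ n) z)" by (rule norm_triangle_ineq4)
      finally show ?thesis using c[of n] by simp
    qed
    then show "y = 0"
      using reals_Archimedean3[of "norm y"] by (metis linorder_not_less zero_less_norm_iff)
  qed
  have "subspace (range g)"
    by (rule linear_subspace_image[OF g subspace_UNIV])
  moreover have "subspace (g ` range g)"
    by (rule linear_subspace_image[OF g \<open>subspace (range g)\<close>])
  moreover have "inj_on g (range g)"
    using eq_0 linear_inj_on_iff_eq_0[OF g \<open>subspace (range g)\<close>] by blast
  then have "dim (g ` range g) = dim (range g)"
    by (intro dim_image_eq[OF g]) (simp add: span_eq_iff[THEN iffD2, OF \<open>subspace (range g)\<close>])
  ultimately have "g ` range g = range g"
    by (intro subspace_dim_equal) auto
  then obtain z where "g x = g (g z)" by blast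
  then have "g (x - g z) = 0" by (simp add: linear_diff[OF g])
  then show thesis
    by (intro that[of "x - g z" z]) (simp_all add: g_def)
qed

lemma tendsto_cesaro_zero:
  fixes a :: "nat \<Rightarrow> 'a::real_normed_vector"
  assumes a: "a \<longlonglongrightarrow> 0"
  shows "(\<lambda>n. (1 / real n) *\<^sub>R (\<Sum>i<n. a i)) \<longlonglongrightarrow> 0"
proof (rule LIMSEQ_I)
  fix e :: real assume e: "0 < e"
  obtain m where m: "norm (a i) < e / 2" if "i \<ge> m" for i
    using LIMSEQ_D[OF a, of "e / 2"] e by auto
  define c where "c = (\<Sum>i<m. norm (a i))"
  \<comment> \<open>From \<open>n \<ge> k\<close> on, the fixed head \<open>c\<close> is below
    \<open>n * e / 2\<close>, the share left over by the tail; \<open>Suc m\<close> in the threshold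
    below also keeps \<open>n\<close> positive.\<close>
  obtain k where k: "2 * c / e < real k" using reals_Archimedean2 by blast
  show "\<exists>no. \<forall>n\<ge>no. norm ((1 / real n) *\<^sub>R (\<Sum>i<n. a i) - 0) < e"
  proof (intro exI allI impI)
    fix n assume n: "n \<ge> max (Suc m) k"
    have "(\<Sum>i<n. norm (a i)) = c + (\<Sum>i=m..<n. norm (a i))"
      unfolding c_def lessThan_atLeast0 using n by (intro sum.atLeastLessThan_concat[symmetric]) auto
    also have "(\<Sum>i=m..<n. norm (a i)) \<le> (\<Sum>i=m..<n. e / 2)"
      by (intro sum_mono order.strict_implies_order[OF m]) simp
    also have "\<dots> \<le> real n * (e / 2)"
      using e n by (auto intro!: mult_right_mono)
    also have "c < real n * (e / 2)"
    proof -
      have "2 * c / e < real n" using k n by simp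
      then show ?thesis using e by (simp add: field_simps)
    qed
    finally have *: "(\<Sum>i<n. norm (a i)) < real n * e" by linarith
    have "norm (\<Sum>i<n. a i) < real n * e"
      by (rule le_less_trans[OF norm_sum *])
    then show "norm ((1 / real n) *\<^sub>R (\<Sum>i<n. a i) - 0) < e"
      using n by (simp add: field_simps)
  qed
qed

lemma tendsto_cesaro:
  fixes a :: "nat \<Rightarrow> 'a::real_normed_vector"
  assumes a: "a \<longlonglongrightarrow> l"
  shows "(\<lambda>n. (1 / real n) *\<^sub>R (\<Sum>i<n. a i)) \<longlonglongrightarrow> l"
proof -
  have "(\<lambda>n. (1 / real n) *\<^sub>R (\<Sum>i<n. a i - l) + l) \<longlonglongrightarrow> 0 + l"
    by (intro tendsto_add tendsto_const tendsto_cesaro_zero LIM_zero a)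
  moreover have "(1 / real n) *\<^sub>R (\<Sum>i<n. a i - l) + l = (1 / real n) *\<^sub>R (\<Sum>i<n. a i)" if "n > 0" for n
    using that by (simp add: sum_subtractf scaleR_diff_right sum_constant_scaleR del: sum_constant)
  then have "\<forall>\<^sub>F n in sequentially. (1 / real n) *\<^sub>R (\<Sum>i<n. a i - l) + l = (1 / real n) *\<^sub>R (\<Sum>i<n. a i)"
    by (rule eventually_sequentiallyI[of 1]) simp
  ultimately show ?thesis
    using Lim_transform_eventually by fastforce
qed

text \<open>Summation by parts: with \<open>R\<close> the partial sums of the weighted series, the
  mean of \<open>d\<close> is \<open>R n\<close> minus the Cesaro mean of \<open>R\<close>, and both
  have the same limit.\<close>

lemma kronecker_lemma:
  fixes d :: "nat \<Rightarrow> 'a::real_normed_vector"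
  assumes "summable (\<lambda>i. (1 / real (Suc i)) *\<^sub>R d i)"
  shows "(\<lambda>n. (1 / real n) *\<^sub>R (\<Sum>i<n. d i)) \<longlonglongrightarrow> 0"
proof -
  define R where "R n = (\<Sum>i<n. (1 / real (Suc i)) *\<^sub>R d i)" for n
  obtain l where l: "R \<longlonglongrightarrow> l"
    using assms by (auto simp: summable_def sums_def R_def[abs_def])
  have abel: "(\<Sum>i<n. d i) = real n *\<^sub>R R n - (\<Sum>i<n. R i)" for n
  proof (induction n)
    case (Suc n)
    have "real (Suc n) *\<^sub>R R (Suc n) = real (Suc n) *\<^sub>R R n + d n"
      by (simp add: R_def scaleR_add_right del: of_nat_Suc)
    then show ?case using Suc by (simp add: algebra_simps)
  qed simp
  have "(\<lambda>n. R n - (1 / real n) *\<^sub>R (\<Sum>i<n. R i)) \<longlonglongrightarrow> l - l"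
    by (intro tendsto_diff l tendsto_cesaro)
  moreover have "R n - (1 / real n) *\<^sub>R (\<Sum>i<n. R i) = (1 / real n) *\<^sub>R (\<Sum>i<n. d i)" if "n \<ge> 1" for n
    using that by (simp add: abel scaleR_diff_right)
  then have "\<forall>\<^sub>F n in sequentially. R n - (1 / real n) *\<^sub>R (\<Sum>i<n. R i) = (1 / real n) *\<^sub>R (\<Sum>i<n. d i)"
    by (rule eventually_sequentiallyI)
  ultimately show ?thesis
    using Lim_transform_eventually by fastforce
qed

section \<open>Functions of finitely many coordinates\<close>

section \<open>Martingale differences on path space\<close>

text \<open>Stands for measurability with respect to the coordinates
  \<open>0, \<dots>, n - 1\<close>. With finitely many states this set-theoretic form is enough and
  spares the filtration of sub-sigma-algebras.\<close>

definition prefix_fun :: "nat \<Rightarrow> ((nat \<Rightarrow> 'w) \<Rightarrow> 'b) \<Rightarrow> bool" where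
  "prefix_fun n g \<longleftrightarrow> (\<forall>\<omega> \<omega>'. (\<forall>i<n. \<omega> i = \<omega>' i) \<longrightarrow> g \<omega> = g \<omega>')"

lemma prefix_funI: "(\<And>\<omega> \<omega>'. (\<And>i. i < n \<Longrightarrow> \<omega> i = \<omega>' i) \<Longrightarrow> g \<omega> = g \<omega>') \<Longrightarrow> prefix_fun n g"
  unfolding prefix_fun_def by blast

lemma prefix_funD: "prefix_fun n g \<Longrightarrow> (\<And>i. i < n \<Longrightarrow> \<omega> i = \<omega>' i) \<Longrightarrow> g \<omega> = g \<omega>'"
  unfolding prefix_fun_def by blast

lemma prefix_fun_mono:
  assumes "prefix_fun m g" "m \<le> n"
  shows "prefix_fun n g"
  using assms(2) by (intro prefix_funI prefix_funD[OF assms(1)]) auto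

lemma prefix_fun_const: "prefix_fun n (\<lambda>_. c)"
  by (simp add: prefix_fun_def)

lemma prefix_fun_comp:
  assumes "prefix_fun n g"
  shows "prefix_fun n (\<lambda>\<omega>. h (g \<omega>))"
proof (rule prefix_funI)
  fix \<omega> \<omega>' :: "nat \<Rightarrow> 'a" assume "\<And>i. i < n \<Longrightarrow> \<omega> i = \<omega>' i"
  then have "g \<omega> = g \<omega>'" using prefix_funD[OF assms, of \<omega> \<omega>'] by blast
  then show "h (g \<omega>) = h (g \<omega>')" by simp
qed

lemma prefix_fun_comp2:
  assumes "prefix_fun n f" "prefix_fun n g"
  shows "prefix_fun n (\<lambda>\<omega>. h (f \<omega>) (g \<omega>))"
proof (rule prefix_funI)
  fix \<omega> \<omega>' :: "nat \<Rightarrow> 'a" assume "\<And>i. i < n \<Longrightarrow> \<omega> i = \<omega>' i"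
  then have "f \<omega> = f \<omega>'" "g \<omega> = g \<omega>'"
    using prefix_funD[OF assms(1), of \<omega> \<omega>'] prefix_funD[OF assms(2), of \<omega> \<omega>'] by blast+
  then show "h (f \<omega>) (g \<omega>) = h (f \<omega>') (g \<omega>')" by simp
qed

lemma prefix_fun_component: "i < n \<Longrightarrow> prefix_fun n (\<lambda>\<omega>. \<omega> i)"
  by (simp add: prefix_fun_def)

lemma prefix_fun_sum:
  assumes "\<And>i. i \<in> I \<Longrightarrow> prefix_fun n (f i)"
  shows "prefix_fun n (\<lambda>\<omega>. \<Sum>i\<in>I. f i \<omega>)"
proof (rule prefix_funI)
  fix \<omega> \<omega>' :: "nat \<Rightarrow> 'b" assume "\<And>i. i < n \<Longrightarrow> \<omega> i = \<omega>' i"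
  then have "f i \<omega> = f i \<omega>'" if "i \<in> I" for i
    using prefix_funD[OF assms[OF that], of \<omega> \<omega>'] by blast
  then show "(\<Sum>i\<in>I. f i \<omega>) = (\<Sum>i\<in>I. f i \<omega>')" by (rule sum.cong[OF refl])
qed

lemma prefix_fun_restrict:
  assumes "prefix_fun n g"
  shows "g \<omega> = g (restrict \<omega> {..<n})"
  using prefix_funD[OF assms, of \<omega> "restrict \<omega> {..<n}"] by simp

locale path_prob_space = prob_space M for M :: "(nat \<Rightarrow> 'w::finite) measure" +
  assumes sets_path: "sets M = sets path_space"
begin

lemma space_path: "space M = UNIV"
  using sets_eq_imp_space_eq[OF sets_path] by (simp add: space_PiM)

lemma measurable_path: "f \<in> M \<rightarrow>\<^sub>M N \<longleftrightarrow> f \<in> path_space \<rightarrow>\<^sub>M N"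
  by (simp only: measurable_cong_sets[OF sets_path refl])

lemma cylinder_measurable: "{\<omega>. \<forall>i<n. \<omega> i = \<nu> i} \<in> sets M"
proof (cases n)
  case 0
  then show ?thesis using sets.top[of M] by (simp add: space_path)
next
  case (Suc m)
  then show ?thesis using cylinder_sets[of m \<nu>] by (simp add: sets_path less_Suc_eq_le)
qed

lemma finite_range_prefix_fun:
  fixes g :: "(nat \<Rightarrow> 'w) \<Rightarrow> 'b"
  assumes "prefix_fun n g"
  shows "finite (range g)"
proof (rule finite_subset)
  show "range g \<subseteq> g ` Pi\<^sub>E {..<n} (\<lambda>_. UNIV)"
  proof
    fix y assume "y \<in> range g"
    then obtain \<omega> where "y = g (restrict \<omega> {..<n})"
      using prefix_fun_restrict[OF assms] by auto
    then show "y \<in> g ` Pi\<^sub>E {..<n} (\<lambda>_. UNIV)" by auto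
  qed
  show "finite (g ` Pi\<^sub>E {..<n} (\<lambda>_. UNIV))"
    by (intro finite_imageI finite_PiE) auto
qed

text \<open>Level sets are finite unions of cylinders because there are finitely many states.
  Measurability and integrability of all adapted quantities follow from this.\<close>

lemma simple_function_prefix_fun:
  assumes g: "prefix_fun n g"
  shows "simple_function M g"
  unfolding simple_function_def
proof (intro conjI ballI)
  show "finite (g ` space M)"
    using finite_range_prefix_fun[OF g] by (simp add: space_path)
  fix x
  define S where "S = {\<nu> \<in> Pi\<^sub>E {..<n} (\<lambda>_. UNIV). g \<nu> = x}"
  have "finite S"
    unfolding S_def by (rule finite_subset[of _ "Pi\<^sub>E {..<n} (\<lambda>_. UNIV)"]) (auto intro!: finite_PiE)
  moreover have "g -` {x} \<inter> space M = (\<Union>\<nu>\<in>S. {\<omega>. \<forall>i<n. \<omega> i = \<nu> i})"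
  proof (intro set_eqI iffI)
    fix \<omega> assume "\<omega> \<in> g -` {x} \<inter> space M"
    then have "restrict \<omega> {..<n} \<in> S" "\<omega> \<in> {\<omega>'. \<forall>i<n. \<omega>' i = restrict \<omega> {..<n} i}"
      using prefix_fun_restrict[OF g, of \<omega>] by (auto simp: S_def)
    then show "\<omega> \<in> (\<Union>\<nu>\<in>S. {\<omega>. \<forall>i<n. \<omega> i = \<nu> i})" by blast
  next
    fix \<omega> assume "\<omega> \<in> (\<Union>\<nu>\<in>S. {\<omega>. \<forall>i<n. \<omega> i = \<nu> i})"
    then obtain \<nu> where "\<nu> \<in> S" "\<forall>i<n. \<omega> i = \<nu> i" by blast
    then show "\<omega> \<in> g -` {x} \<inter> space M"
      using prefix_funD[OF g, of \<omega> \<nu>] by (simp add: S_def space_path)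
  qed
  ultimately show "g -` {x} \<inter> space M \<in> sets M"
    by (auto intro!: sets.finite_UN cylinder_measurable)
qed

lemma borel_measurable_prefix_fun:
  fixes g :: "(nat \<Rightarrow> 'w) \<Rightarrow> 'b::{second_countable_topology, banach}"
  shows "prefix_fun n g \<Longrightarrow> g \<in> borel_measurable M"
  by (rule borel_measurable_simple_function[OF simple_function_prefix_fun])

lemma prefix_event: "prefix_fun n Q \<Longrightarrow> {\<omega>. Q \<omega>} \<in> sets M"
  using simple_functionD(2)[OF simple_function_prefix_fun, of n Q "{True}"]
  by (simp add: space_path vimage_def)

lemma integrable_prefix_fun:
  fixes g :: "(nat \<Rightarrow> 'w) \<Rightarrow> 'b::{second_countable_topology, banach}"
  assumes g: "prefix_fun n g"
  shows "integrable M g"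
proof (rule integrable_const_bound)
  have "finite (norm ` range g)" using finite_range_prefix_fun[OF g] by simp
  then show "AE \<omega> in M. norm (g \<omega>) \<le> Max (norm ` range g)" by simp
qed (rule borel_measurable_prefix_fun[OF g])

end

section \<open>Square-integrable martingales: maximal inequality, convergence, strong law\<close>

text \<open>\<open>orthogonal\<close> expresses that \<open>d n\<close> has conditional mean zero
  given the coordinates below \<open>n\<close>, without conditional expectations: the vector-valued
  test functions do not see coordinate \<open>n\<close>, which \<open>d n\<close> may use.\<close>

locale path_martingale_diff = path_prob_space M for M :: "(nat \<Rightarrow> 'w::finite) measure" +
  fixes d :: "nat \<Rightarrow> (nat \<Rightarrow> 'w) \<Rightarrow> 'b::euclidean_space"
  assumes adapted: "prefix_fun (Suc n) (d n)"
    and orthogonal: "prefix_fun n g \<Longrightarrow> (\<integral>\<omega>. g \<omega> \<bullet> d n \<omega> \<partial>M) = 0"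
begin

definition energy :: "nat \<Rightarrow> real" where
  "energy n = (\<integral>\<omega>. (norm (d n \<omega>))\<^sup>2 \<partial>M)"

lemma energy_nonneg: "0 \<le> energy n"
  by (simp add: energy_def)

lemma adapted_partial_sum: "prefix_fun n (\<lambda>\<omega>. \<Sum>i<n. d i \<omega>)"
  by (intro prefix_fun_sum prefix_fun_mono[OF adapted]) simp

text \<open>Pythagoras: the partial sum before \<open>d n\<close> depends only on coordinates below
  \<open>n\<close>, so the cross term integrates to zero.\<close>

lemma energy_partial_sum: "(\<integral>\<omega>. (norm (\<Sum>i<n. d i \<omega>))\<^sup>2 \<partial>M) = (\<Sum>i<n. energy i)"
proof (induction n)
  case (Suc n)
  let ?S = "\<lambda>\<omega>. \<Sum>i<n. d i \<omega>"
  have S: "prefix_fun (Suc n) ?S"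
    by (rule prefix_fun_mono[OF adapted_partial_sum]) simp
  have [simp]: "integrable M (\<lambda>\<omega>. (norm (?S \<omega>))\<^sup>2)" "integrable M (\<lambda>\<omega>. (norm (d n \<omega>))\<^sup>2)"
      "integrable M (\<lambda>\<omega>. ?S \<omega> \<bullet> d n \<omega>)"
    by (auto intro!: integrable_prefix_fun[where n = "Suc n"] prefix_fun_comp[OF S]
        prefix_fun_comp[OF adapted] prefix_fun_comp2[OF S adapted])
  have "(norm (?S \<omega> + d n \<omega>))\<^sup>2 = (norm (?S \<omega>))\<^sup>2 + (norm (d n \<omega>))\<^sup>2 + 2 * (?S \<omega> \<bullet> d n \<omega>)" for \<omega>
    by (simp add: power2_norm_eq_inner inner_add_left inner_add_right inner_commute)
  then have "(\<integral>\<omega>. (norm (\<Sum>i<Suc n. d i \<omega>))\<^sup>2 \<partial>M)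
      = (\<integral>\<omega>. (norm (?S \<omega>))\<^sup>2 \<partial>M) + energy n + 2 * (\<integral>\<omega>. ?S \<omega> \<bullet> d n \<omega> \<partial>M)"
    by (simp add: energy_def)
  then show ?case
    using Suc orthogonal[OF adapted_partial_sum, of n] by simp
qed simp

text \<open>A martingale transform with a 0-1 factor known from the coordinates below
  \<open>n\<close>: the factor moves onto the test function. This yields both the stopped martingale
  and the one with its first terms removed.\<close>

lemma gated:
  assumes B: "\<And>n. prefix_fun n (B n)"
  shows "path_martingale_diff M (\<lambda>n \<omega>. if B n \<omega> then d n \<omega> else 0)"
proof
  show "prefix_fun (Suc n) (\<lambda>\<omega>. if B n \<omega> then d n \<omega> else 0)" for n
    by (rule prefix_fun_comp2[OF prefix_fun_mono[OF B[of n]] adapted[of n],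
          where h = "\<lambda>b x. if b then x else 0"]) simp
  fix n and g :: "(nat \<Rightarrow> 'w) \<Rightarrow> 'b" assume "prefix_fun n g"
  then have "prefix_fun n (\<lambda>\<omega>. if B n \<omega> then g \<omega> else 0)"
    by (rule prefix_fun_comp2[OF B, where h = "\<lambda>b x. if b then x else 0"])
  then have "(\<integral>\<omega>. (if B n \<omega> then g \<omega> else 0) \<bullet> d n \<omega> \<partial>M) = 0" by (rule orthogonal)
  moreover have "g \<omega> \<bullet> (if B n \<omega> then d n \<omega> else 0) = (if B n \<omega> then g \<omega> else 0) \<bullet> d n \<omega>" for \<omega>
    by simp
  ultimately show "(\<integral>\<omega>. g \<omega> \<bullet> (if B n \<omega> then d n \<omega> else 0) \<partial>M) = 0" by simp
qed

text \<open>Apply \<open>energy_partial_sum\<close> to the martingale stopped when its norm first reaches \<open>e\<close>.\<close>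

lemma maximal_inequality_finite:
  assumes e: "0 < e"
  shows "e\<^sup>2 * prob {\<omega>. \<exists>k\<le>n. e \<le> norm (\<Sum>i<k. d i \<omega>)} \<le> (\<Sum>i<n. energy i)"
proof -
  define S where "S k \<omega> = (\<Sum>i<k. d i \<omega>)" for k \<omega>
  \<comment> \<open>\<open>S j\<close> with \<open>j \<le> k\<close> uses only coordinates below
    \<open>k\<close>, so this gate is known before \<open>d k\<close> is revealed.\<close>
  define B where "B k \<omega> \<longleftrightarrow> (\<forall>j\<le>k. norm (S j \<omega>) < e)" for k \<omega>
  have prefix_S: "prefix_fun k (S j)" if "j \<le> k" for j k
    unfolding S_def using that adapted_partial_sum prefix_fun_mono by blast
  have prefix_B: "prefix_fun k (B k)" for k
  proof (rule prefix_funI)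
    fix \<omega> \<omega>' :: "nat \<Rightarrow> 'w" assume "\<And>i. i < k \<Longrightarrow> \<omega> i = \<omega>' i"
    then have "S j \<omega> = S j \<omega>'" if "j \<le> k" for j
      using prefix_funD[OF prefix_S[OF that], of \<omega> \<omega>'] by blast
    then show "B k \<omega> = B k \<omega>'" by (simp add: B_def)
  qed
  interpret G: path_martingale_diff M "\<lambda>k \<omega>. if B k \<omega> then d k \<omega> else 0"
    by (rule gated[OF prefix_B])
  have stopped: "e \<le> norm (\<Sum>i<n. if B i \<omega> then d i \<omega> else 0)"
    if ex: "\<exists>k\<le>n. e \<le> norm (S k \<omega>)" for \<omega>
  proof -
    define k where "k = (LEAST k. e \<le> norm (S k \<omega>))"
    obtain l where l: "l \<le> n" "e \<le> norm (S l \<omega>)" using ex by blast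
    have k: "e \<le> norm (S k \<omega>)" unfolding k_def using l(2) by (rule LeastI)
    have "k \<le> l" unfolding k_def using l(2) by (rule Least_le)
    with l(1) have kn: "k \<le> n" by simp
    \<comment> \<open>\<open>k\<close> is the first time the norm reaches \<open>e\<close>; the gate
      is open exactly before it, so the gated sum stays frozen at \<open>S k\<close>.\<close>
    have B_iff: "B i \<omega> \<longleftrightarrow> i < k" for i
    proof
      assume "B i \<omega>"
      then show "i < k" using k by (meson B_def leD leI)
    next
      assume "i < k"
      then have "\<not> e \<le> norm (S j \<omega>)" if "j \<le> i" for j
        unfolding k_def using that by (intro not_less_Least) simp
      then show "B i \<omega>" by (simp add: B_def not_le)
    qed
    have "(\<Sum>i<n. if B i \<omega> then d i \<omega> else 0) = (\<Sum>i\<in>{..<n} \<inter> {..<k}. d i \<omega>)"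
      unfolding B_iff by (subst sum.inter_restrict) auto
    also have "{..<n} \<inter> {..<k} = {..<k}" using kn by auto
    finally show ?thesis using k by (simp add: S_def)
  qed
  let ?A = "{\<omega>. \<exists>k\<le>n. e \<le> norm (S k \<omega>)}"
  have A: "?A \<in> sets M"
  proof (rule prefix_event[where n = n], rule prefix_funI)
    fix \<omega> \<omega>' :: "nat \<Rightarrow> 'w" assume "\<And>i. i < n \<Longrightarrow> \<omega> i = \<omega>' i"
    then have "S k \<omega> = S k \<omega>'" if "k \<le> n" for k
      using prefix_funD[OF prefix_S[OF that], of \<omega> \<omega>'] by blast
    then show "(\<exists>k\<le>n. e \<le> norm (S k \<omega>)) = (\<exists>k\<le>n. e \<le> norm (S k \<omega>'))"
      by (simp cong: conj_cong)
  qed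
  have "e\<^sup>2 * prob ?A = (\<integral>\<omega>. e\<^sup>2 * indicator ?A \<omega> \<partial>M)"
    using A by simp
  also have "\<dots> \<le> (\<integral>\<omega>. (norm (\<Sum>i<n. if B i \<omega> then d i \<omega> else 0))\<^sup>2 \<partial>M)"
  proof (rule integral_mono)
    show "integrable M (\<lambda>\<omega>. e\<^sup>2 * indicator ?A \<omega>)"
      using A by (simp add: emeasure_eq_measure)
    show "integrable M (\<lambda>\<omega>. (norm (\<Sum>i<n. if B i \<omega> then d i \<omega> else 0))\<^sup>2)"
      by (rule integrable_prefix_fun[OF prefix_fun_comp[OF G.adapted_partial_sum]])
    fix \<omega> show "e\<^sup>2 * indicator ?A \<omega> \<le> (norm (\<Sum>i<n. if B i \<omega> then d i \<omega> else 0))\<^sup>2"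
      using stopped[of \<omega>] e by (auto simp: indicator_def intro!: power_mono)
  qed
  also have "\<dots> = (\<Sum>i<n. G.energy i)" by (rule G.energy_partial_sum)
  also have "\<dots> \<le> (\<Sum>i<n. energy i)"
  proof (rule sum_mono)
    fix i show "G.energy i \<le> energy i"
      unfolding G.energy_def energy_def
      by (intro integral_mono integrable_prefix_fun[OF prefix_fun_comp[OF G.adapted]]
          integrable_prefix_fun[OF prefix_fun_comp[OF adapted]]) auto
  qed
  finally show ?thesis by (simp add: S_def)
qed

lemma partial_sum_event:
  "{\<omega>. \<exists>k. e \<le> norm (\<Sum>i<k. d i \<omega>)} \<in> sets M"
proof -
  have "{\<omega>. e \<le> norm (\<Sum>i<k. d i \<omega>)} \<in> sets M" for k
    by (rule prefix_event[where n = k], rule prefix_fun_comp[OF adapted_partial_sum])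
  then have "(\<Union>k. {\<omega>. e \<le> norm (\<Sum>i<k. d i \<omega>)}) \<in> sets M" by blast
  also have "(\<Union>k. {\<omega>. e \<le> norm (\<Sum>i<k. d i \<omega>)}) = {\<omega>. \<exists>k. e \<le> norm (\<Sum>i<k. d i \<omega>)}" by blast
  finally show ?thesis .
qed

text \<open>The events with \<open>k \<le> n\<close> increase to the event in question, so
  continuity from below carries the finite bound over.\<close>

lemma maximal_inequality:
  assumes e: "0 < e" and "summable energy"
  shows "e\<^sup>2 * prob {\<omega>. \<exists>k. e \<le> norm (\<Sum>i<k. d i \<omega>)} \<le> (\<Sum>i. energy i)"
proof -
  define A where "A n = {\<omega>. \<exists>k\<le>n. e \<le> norm (\<Sum>i<k. d i \<omega>)}" for n
  have "A n \<in> sets M" for n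
  proof -
    have "(\<Union>k\<in>{..n}. {\<omega>. e \<le> norm (\<Sum>i<k. d i \<omega>)}) \<in> sets M"
      by (intro sets.finite_UN) (auto intro: prefix_event[OF prefix_fun_comp[OF adapted_partial_sum]])
    also have "(\<Union>k\<in>{..n}. {\<omega>. e \<le> norm (\<Sum>i<k. d i \<omega>)}) = A n" by (auto simp: A_def)
    finally show ?thesis .
  qed
  moreover have "incseq A" unfolding A_def incseq_def by (auto intro: order_trans)
  ultimately have "(\<lambda>n. prob (A n)) \<longlonglongrightarrow> prob (\<Union>n. A n)"
    by (intro finite_Lim_measure_incseq) auto
  also have "(\<Union>n. A n) = {\<omega>. \<exists>k. e \<le> norm (\<Sum>i<k. d i \<omega>)}" by (auto simp: A_def)
  finally have "(\<lambda>n. e\<^sup>2 * prob (A n)) \<longlonglongrightarrow> e\<^sup>2 * prob {\<omega>. \<exists>k. e \<le> norm (\<Sum>i<k. d i \<omega>)}"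
    by (intro tendsto_intros)
  then show ?thesis
  proof (rule LIMSEQ_le_const2, intro exI allI impI)
    fix n
    have "e\<^sup>2 * prob (A n) \<le> (\<Sum>i<n. energy i)"
      unfolding A_def by (rule maximal_inequality_finite[OF e])
    also have "\<dots> \<le> (\<Sum>i. energy i)"
      using assms(2) energy_nonneg by (intro sum_le_suminf) auto
    finally show "e\<^sup>2 * prob (A n) \<le> (\<Sum>i. energy i)" .
  qed
qed

text \<open>Gating off the indices below \<open>m\<close> leaves a martingale whose total energy is
  the tail of the series. The maximal inequality then bounds the probability of \<open>A m\<close>
  by a quantity tending to 0, so the intersection of all \<open>A m\<close> is null.\<close>

lemma AE_tail_small:
  assumes e: "0 < e" and summ: "summable energy"
  shows "AE \<omega> in M. \<exists>m. \<forall>k\<ge>m. norm (\<Sum>i=m..<k. d i \<omega>) < e"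
proof -
  define A where "A m = {\<omega>. \<exists>k. e \<le> norm (\<Sum>i<k. if m \<le> i then d i \<omega> else 0)}" for m
  have A: "A m \<in> sets M" "e\<^sup>2 * prob (A m) \<le> (\<Sum>i. energy (i + m))" for m
  proof -
    interpret G: path_martingale_diff M "\<lambda>i \<omega>. if m \<le> i then d i \<omega> else 0"
      by (rule gated) (rule prefix_fun_const)
    show "A m \<in> sets M" unfolding A_def by (rule G.partial_sum_event)
    have G: "G.energy = (\<lambda>i. if m \<le> i then energy i else 0)"
      by (auto simp: G.energy_def energy_def)
    have "summable (\<lambda>i. G.energy (i + m))"
      using summ by (simp add: G summable_iff_shift)
    then have G_summ: "summable G.energy" by (simp only: summable_iff_shift)
    have "e\<^sup>2 * prob (A m) \<le> suminf G.energy"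
      unfolding A_def by (rule G.maximal_inequality[OF e G_summ])
    also have "\<dots> = (\<Sum>i. G.energy (i + m)) + (\<Sum>i<m. G.energy i)"
      by (rule suminf_split_initial_segment[OF G_summ])
    also have "\<dots> = (\<Sum>i. energy (i + m))" by (simp add: G)
    finally show "e\<^sup>2 * prob (A m) \<le> (\<Sum>i. energy (i + m))" .
  qed
  have "e\<^sup>2 * prob (\<Inter>m. A m) \<le> (\<Sum>i. energy (i + m))" for m
  proof -
    have "prob (\<Inter>m. A m) \<le> prob (A m)" using A(1) by (intro finite_measure_mono) auto
    then show ?thesis using A(2)[of m] by (meson mult_left_mono order_trans zero_le_power2)
  qed
  moreover have "(\<lambda>m. \<Sum>i. energy (i + m)) \<longlonglongrightarrow> 0"
    using summ by (rule suminf_exist_split2)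
  ultimately have "e\<^sup>2 * prob (\<Inter>m. A m) \<le> 0"
    by (intro LIMSEQ_le_const[where X = "\<lambda>m. \<Sum>i. energy (i + m)"]) auto
  then have "prob (\<Inter>m. A m) = 0"
    using e by (simp add: mult_le_0_iff measure_le_0_iff)
  moreover have "(\<Inter>m. A m) \<in> sets M" using A(1) by auto
  ultimately have "AE \<omega> in M. \<omega> \<notin> (\<Inter>m. A m)"
    by (intro AE_not_in null_setsI) (simp_all add: emeasure_eq_measure)
  moreover have "\<exists>m. \<forall>k\<ge>m. norm (\<Sum>i=m..<k. d i \<omega>) < e" if notin: "\<omega> \<notin> (\<Inter>m. A m)" for \<omega>
  proof -
    from notin obtain m where m: "norm (\<Sum>i<k. if m \<le> i then d i \<omega> else 0) < e" for k
      by (auto simp: A_def not_le)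
    have "(\<Sum>i<k. if m \<le> i then d i \<omega> else 0) = (\<Sum>i=m..<k. d i \<omega>)" for k
    proof -
      have "{m..<k} = {..<k} \<inter> {i. m \<le> i}" by auto
      then show ?thesis by (simp add: sum.inter_restrict)
    qed
    with m show ?thesis by auto
  qed
  ultimately show ?thesis by (auto elim: eventually_mono)
qed

lemma AE_summable:
  assumes summ: "summable energy"
  shows "AE \<omega> in M. summable (\<lambda>i. d i \<omega>)"
proof -
  have "AE \<omega> in M. \<forall>j::nat. \<exists>m. \<forall>k\<ge>m. norm (\<Sum>i=m..<k. d i \<omega>) < 1 / real (Suc j)"
    unfolding AE_all_countable using AE_tail_small[OF _ summ] by simp
  then show ?thesis
  proof (rule eventually_mono)
    fix \<omega> assume tail: "\<forall>j::nat. \<exists>m. \<forall>k\<ge>m. norm (\<Sum>i=m..<k. d i \<omega>) < 1 / real (Suc j)"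
    show "summable (\<lambda>i. d i \<omega>)"
      unfolding summable_Cauchy
    proof (intro allI impI)
      fix e :: real assume "0 < e"
      \<comment> \<open>Half of \<open>e\<close> suffices: a block from \<open>l\<close> to
        \<open>k\<close> is the difference of two blocks starting at \<open>m\<close>.\<close>
      then obtain j where j: "1 / real (Suc j) < e / 2"
        using nat_approx_posE[of "e / 2"] by auto
      obtain m where m: "norm (\<Sum>i=m..<k. d i \<omega>) < 1 / real (Suc j)" if "k \<ge> m" for k
        using tail by blast
      have "norm (\<Sum>i=l..<k. d i \<omega>) < e" if "l \<ge> m" for l k
      proof (cases "l \<le> k")
        case True
        have "(\<Sum>i=l..<k. d i \<omega>) = (\<Sum>i=m..<k. d i \<omega>) - (\<Sum>i=m..<l. d i \<omega>)"
          using sum.atLeastLessThan_concat[OF \<open>m \<le> l\<close> True, of "\<lambda>i. d i \<omega>"] by (simp add: eq_diff_eq add.commute)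
        then have "norm (\<Sum>i=l..<k. d i \<omega>) \<le> norm (\<Sum>i=m..<k. d i \<omega>) + norm (\<Sum>i=m..<l. d i \<omega>)"
          by (simp add: norm_triangle_ineq4)
        then show ?thesis using m[of k] m[of l] \<open>l \<ge> m\<close> True j by linarith
      qed (use \<open>0 < e\<close> in simp)
      then show "\<exists>N. \<forall>m\<ge>N. \<forall>n. norm (sum (\<lambda>i. d i \<omega>) {m..<n}) < e" by blast
    qed
  qed
qed

text \<open>Convergence of a bounded martingale: by orthogonality the energies add up to the second
  moment of the partial sum, which is at most \<open>c\<^sup>2\<close>.\<close>

lemma AE_summable_bounded:
  assumes bounded: "\<And>n \<omega>. norm (\<Sum>i<n. d i \<omega>) \<le> c"
  shows "AE \<omega> in M. summable (\<lambda>i. d i \<omega>)"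
proof (intro AE_summable summableI_nonneg_bounded)
  fix n
  have "(\<Sum>i<n. energy i) \<le> (\<integral>\<omega>. c\<^sup>2 \<partial>M)"
    unfolding energy_partial_sum[symmetric]
    by (intro integral_mono integrable_prefix_fun[OF prefix_fun_comp[OF adapted_partial_sum]])
      (auto intro!: power_mono bounded)
  then show "(\<Sum>i<n. energy i) \<le> c\<^sup>2" by (simp add: prob_space)
qed (rule energy_nonneg)

text \<open>Dividing \<open>d i\<close> by \<open>i + 1\<close> gives martingale differences with
  energies at most \<open>c\<^sup>2 / (i + 1)\<^sup>2\<close>. Their series converges almost surely,
  and Kronecker's lemma turns this into vanishing means.\<close>

lemma AE_strong_law:
  assumes bounded: "\<And>n \<omega>. norm (d n \<omega>) \<le> c"
  shows "AE \<omega> in M. (\<lambda>n. (1 / real n) *\<^sub>R (\<Sum>i<n. d i \<omega>)) \<longlonglongrightarrow> 0"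
proof -
  interpret G: path_martingale_diff M "\<lambda>i \<omega>. (1 / real (Suc i)) *\<^sub>R d i \<omega>"
    by unfold_locales (auto intro: prefix_fun_comp[OF adapted] simp: orthogonal)
  have "G.energy i \<le> c\<^sup>2 * (1 / (real (Suc i))\<^sup>2)" for i
  proof -
    have "energy i \<le> (\<integral>\<omega>. c\<^sup>2 \<partial>M)"
      unfolding energy_def
      by (intro integral_mono integrable_prefix_fun[OF prefix_fun_comp[OF adapted]])
        (auto intro!: power_mono bounded)
    then have "energy i \<le> c\<^sup>2" by (simp add: prob_space)
    moreover have "G.energy i = (1 / (real (Suc i))\<^sup>2) * energy i"
      unfolding G.energy_def energy_def
      by (simp add: power_mult_distrib power_divide del: of_nat_Suc)
    ultimately show ?thesis by (simp add: divide_right_mono)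
  qed
  moreover have "summable (\<lambda>i. c\<^sup>2 * (1 / (real (Suc i))\<^sup>2))"
    using inverse_squares_sums by (intro summable_mult) (auto simp: sums_iff)
  ultimately have "summable G.energy"
    using G.energy_nonneg by (intro summable_comparison_test'[of _ 0 G.energy]) auto
  then show ?thesis
    using G.AE_summable by (auto elim!: eventually_mono intro: kronecker_lemma)
qed

end

section \<open>One-step Markov property and the law of the shifted chain\<close>

section \<open>Markov measures\<close>

lemma is_markov_measure_path_prob_space: "is_markov_measure p P M \<Longrightarrow> path_prob_space M"
  by (simp add: is_markov_measure_def path_prob_space_def path_prob_space_axioms_def)

lemma prob_vector_axis: "prob_vector (axis w 1)"
  by (simp add: prob_vector_def axis_def)

lemma markov_cylinder:
  assumes "is_markov_measure p P M"
  shows "measure M {\<omega>. \<forall>i\<le>n. \<omega> i = \<nu> i} = p $ \<nu> 0 * (\<Prod>i<n. P $ \<nu> i $ \<nu> (Suc i))"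
  using assms unfolding is_markov_measure_def by blast

text \<open>\<open>g\<close> is a finite combination of indicators of cylinders over times
  \<open>0, \<dots>, n\<close>, and prescribing the next state \<open>v\<close> multiplies the mass
  of such a cylinder by one transition probability.\<close>

lemma markov_property:
  fixes g :: "(nat \<Rightarrow> 'w::finite) \<Rightarrow> real"
  assumes M: "is_markov_measure p P M" and g: "prefix_fun (Suc n) g"
  shows "(\<integral>\<omega>. g \<omega> * of_bool (\<omega> (Suc n) = v) \<partial>M) = (\<integral>\<omega>. g \<omega> * P $ \<omega> n $ v \<partial>M)"
proof -
  interpret path_prob_space M by (rule is_markov_measure_path_prob_space[OF M])
  define S where "S = Pi\<^sub>E {..<Suc n} (\<lambda>_. UNIV :: 'w set)"
  define C where "C \<nu> = {\<omega>. \<forall>i\<le>n. \<omega> i = \<nu> i}" for \<nu> :: "nat \<Rightarrow> 'w"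
  have S: "finite S" unfolding S_def by (intro finite_PiE) auto
  have C[simp]: "C \<nu> \<in> sets M" for \<nu>
    using cylinder_measurable[of "Suc n" \<nu>] by (simp add: C_def less_Suc_eq_le)
  \<comment> \<open>Exactly one cylinder contains \<omega>: members of \<open>S\<close> are
    \<open>undefined\<close> from \<open>Suc n\<close> on, so the restriction of \<omega> is the
    only candidate.\<close>
  have expand: "f \<omega> = (\<Sum>\<nu>\<in>S. f \<nu> * indicator (C \<nu>) \<omega>)"
    if f: "prefix_fun (Suc n) f" for f :: "(nat \<Rightarrow> 'w) \<Rightarrow> real" and \<omega>
  proof -
    define r where "r = restrict \<omega> {..<Suc n}"
    have r: "r \<in> S" unfolding r_def S_def by (rule restrict_PiE_iff[THEN iffD2]) blast
    have r_eq: "r i = \<omega> i" if "i \<le> n" for i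
      using that by (simp add: r_def)
    have "\<omega> \<in> C \<nu> \<longleftrightarrow> \<nu> = r" if \<nu>: "\<nu> \<in> S" for \<nu>
    proof
      assume "\<omega> \<in> C \<nu>"
      then have "\<nu> i = r i" if "i \<in> {..<Suc n}" for i
        using that r_eq[of i] by (simp add: C_def less_Suc_eq_le)
      then show "\<nu> = r"
        by (rule PiE_ext[OF \<nu>[unfolded S_def] r[unfolded S_def]])
    qed (simp add: C_def r_eq)
    then have "f \<nu> * indicator (C \<nu>) \<omega> = (if \<nu> = r then f r else 0)" if "\<nu> \<in> S" for \<nu>
      using that by (simp add: indicator_def)
    then have "(\<Sum>\<nu>\<in>S. f \<nu> * indicator (C \<nu>) \<omega>) = (\<Sum>\<nu>\<in>S. if \<nu> = r then f r else 0)"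
      by (rule sum.cong[OF refl])
    also have "\<dots> = f r" using S r by (simp only: sum.delta if_True)
    finally show ?thesis using prefix_fun_restrict[OF f, of \<omega>] unfolding r_def by (rule trans[rotated, OF sym])
  qed
  have step: "measure M (C \<nu> \<inter> {\<omega>. \<omega> (Suc n) = v}) = measure M (C \<nu>) * P $ \<nu> n $ v" for \<nu>
  proof -
    \<comment> \<open>The update at \<open>Suc n\<close> leaves the first \<open>n\<close>
      transition factors intact and appends \<open>P $ \<nu> n $ v\<close>.\<close>
    define \<mu> where "\<mu> = \<nu>(Suc n := v)"
    have "C \<nu> \<inter> {\<omega>. \<omega> (Suc n) = v} = {\<omega>. \<forall>i\<le>Suc n. \<omega> i = \<mu> i}"
      by (auto simp: C_def \<mu>_def le_Suc_eq)
    moreover have "(\<Prod>i<n. P $ \<mu> i $ \<mu> (Suc i)) = (\<Prod>i<n. P $ \<nu> i $ \<nu> (Suc i))"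
      by (rule prod.cong) (auto simp: \<mu>_def)
    ultimately show ?thesis
      unfolding C_def by (simp only: markov_cylinder[OF M]) (simp add: \<mu>_def)
  qed
  have event: "{\<omega>. \<omega> (Suc n) = v} \<in> sets M"
    by (rule prefix_event[where n = "Suc (Suc n)"], rule prefix_fun_comp[OF prefix_fun_component]) simp
  have integral_sum_indicator: "(\<integral>\<omega>. (\<Sum>\<nu>\<in>S. f \<nu> * indicator (D \<nu>) \<omega>) \<partial>M) = (\<Sum>\<nu>\<in>S. f \<nu> * prob (D \<nu>))"
    if D: "\<And>\<nu>. D \<nu> \<in> sets M" for f :: "(nat \<Rightarrow> 'w) \<Rightarrow> real" and D
  proof -
    have "integrable M (indicator (D \<nu>) :: _ \<Rightarrow> real)" for \<nu>
      by (rule integrable_real_indicator[OF D]) (simp add: emeasure_eq_measure)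
    then have "(\<integral>\<omega>. (\<Sum>\<nu>\<in>S. f \<nu> * indicator (D \<nu>) \<omega>) \<partial>M) = (\<Sum>\<nu>\<in>S. \<integral>\<omega>. f \<nu> * indicator (D \<nu>) \<omega> \<partial>M)"
      by (intro Bochner_Integration.integral_sum integrable_mult_right)
    then show ?thesis by (simp add: space_path)
  qed
  have "(\<integral>\<omega>. g \<omega> * of_bool (\<omega> (Suc n) = v) \<partial>M)
      = (\<integral>\<omega>. (\<Sum>\<nu>\<in>S. g \<nu> * indicator (C \<nu> \<inter> {\<omega>. \<omega> (Suc n) = v}) \<omega>) \<partial>M)"
  proof (rule Bochner_Integration.integral_cong[OF refl])
    fix \<omega>
    show "g \<omega> * of_bool (\<omega> (Suc n) = v) = (\<Sum>\<nu>\<in>S. g \<nu> * indicator (C \<nu> \<inter> {\<omega>. \<omega> (Suc n) = v}) \<omega>)"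
      unfolding expand[OF g, of \<omega>] sum_distrib_right
      by (rule sum.cong) (simp_all add: indicator_def)
  qed
  also have "\<dots> = (\<Sum>\<nu>\<in>S. g \<nu> * measure M (C \<nu> \<inter> {\<omega>. \<omega> (Suc n) = v}))"
    by (rule integral_sum_indicator) (rule sets.Int[OF C event])
  also have "\<dots> = (\<Sum>\<nu>\<in>S. (g \<nu> * P $ \<nu> n $ v) * measure M (C \<nu>))"
    by (simp add: step mult_ac)
  also have "\<dots> = (\<integral>\<omega>. (\<Sum>\<nu>\<in>S. (g \<nu> * P $ \<nu> n $ v) * indicator (C \<nu>) \<omega>) \<partial>M)"
    by (rule integral_sum_indicator[symmetric]) (rule C)
  also have "\<dots> = (\<integral>\<omega>. g \<omega> * P $ \<omega> n $ v \<partial>M)"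
  proof -
    have "prefix_fun (Suc n) (\<lambda>\<omega>. g \<omega> * P $ \<omega> n $ v)"
      by (intro prefix_fun_comp2[OF g prefix_fun_component]) simp
    from expand[OF this] show ?thesis
      by (intro Bochner_Integration.integral_cong[OF refl]) (rule sym)
  qed
  finally show ?thesis .
qed

lemma left_shift_measurable: "left_shift \<in> path_space \<rightarrow>\<^sub>M (path_space :: (nat \<Rightarrow> 'w) measure)"
  by (rule measurable_PiM_single') (auto simp: left_shift_def[abs_def] space_PiM)

text \<open>The preimage of a cylinder splits according to the forgotten initial state
  \<open>w\<close>; summing \<open>p $ w * P $ w $ \<nu> 0\<close> over \<open>w\<close> gives the
  new initial vector.\<close>

lemma is_markov_measure_left_shift:
  fixes P :: "real^'w^('w::finite)"
  assumes M: "is_markov_measure p P M"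
  shows "is_markov_measure (p v* P) P (distr M path_space left_shift)"
proof -
  interpret path_prob_space M by (rule is_markov_measure_path_prob_space[OF M])
  have meas: "left_shift \<in> M \<rightarrow>\<^sub>M (path_space :: (nat \<Rightarrow> 'w) measure)"
    by (rule measurable_path[THEN iffD2, OF left_shift_measurable])
  have "measure (distr M path_space left_shift) {\<omega>. \<forall>i\<le>n. \<omega> i = \<nu> i}
      = (p v* P) $ \<nu> 0 * (\<Prod>i<n. P $ \<nu> i $ \<nu> (Suc i))" for n \<nu>
  proof -
    define C where "C w = {\<omega>. \<forall>i\<le>Suc n. \<omega> i = case_nat w \<nu> i}" for w
    have C: "measure M (C w) = p $ w * P $ w $ \<nu> 0 * (\<Prod>i<n. P $ \<nu> i $ \<nu> (Suc i))" for w
      unfolding C_def markov_cylinder[OF M] by (subst prod.lessThan_Suc_shift) simp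
    have "left_shift -` {\<omega>. \<forall>i\<le>n. \<omega> i = \<nu> i} \<inter> space M = (\<Union>w. C w)"
    proof (intro set_eqI iffI)
      fix \<omega> assume "\<omega> \<in> left_shift -` {\<omega>. \<forall>i\<le>n. \<omega> i = \<nu> i} \<inter> space M"
      then have "\<omega> \<in> C (\<omega> 0)"
        unfolding C_def by (auto simp: left_shift_def split: nat.split)
      then show "\<omega> \<in> (\<Union>w. C w)" by blast
    next
      fix \<omega> assume "\<omega> \<in> (\<Union>w. C w)"
      then obtain w where w: "\<omega> i = case_nat w \<nu> i" if "i \<le> Suc n" for i
        by (auto simp: C_def)
      have "\<omega> (Suc i) = \<nu> i" if "i \<le> n" for i
        using w[of "Suc i"] that by simp
      then show "\<omega> \<in> left_shift -` {\<omega>. \<forall>i\<le>n. \<omega> i = \<nu> i} \<inter> space M"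
        by (simp add: left_shift_def space_path)
    qed
    then have "measure (distr M path_space left_shift) {\<omega>. \<forall>i\<le>n. \<omega> i = \<nu> i} = measure M (\<Union>w. C w)"
      by (subst measure_distr[OF meas cylinder_sets]) simp
    also have "\<dots> = (\<Sum>w\<in>UNIV. measure M (C w))"
    proof (rule finite_measure_finite_Union)
      show "disjoint_family_on C UNIV"
        unfolding disjoint_family_on_def
      proof (intro ballI impI equals0I)
        fix w w' \<omega> assume "w \<noteq> w'" "\<omega> \<in> C w \<inter> C w'"
        then have "\<omega> 0 = w" "\<omega> 0 = w'" unfolding C_def by force+
        with \<open>w \<noteq> w'\<close> show False by simp
      qed
      show "range C \<subseteq> sets M"
        using cylinder_measurable[of "Suc (Suc n)"] by (auto simp: C_def less_Suc_eq_le)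
    qed simp
    also have "\<dots> = (p v* P) $ \<nu> 0 * (\<Prod>i<n. P $ \<nu> i $ \<nu> (Suc i))"
      unfolding C vector_matrix_mult_def vec_lambda_beta sum_distrib_right by (simp add: mult_ac)
    finally show ?thesis .
  qed
  then show ?thesis
    by (simp add: is_markov_measure_def prob_space_distr[OF meas])
qed

text \<open>Carries almost sure statements about Markov measures over to the chain that starts at
  \<omega> 1; applying it twice reaches the chain that starts at \<omega> 2.\<close>

lemma AE_left_shift:
  assumes M: "is_markov_measure p P M"
    and AE: "\<And>N. is_markov_measure (p v* P) P N \<Longrightarrow> AE \<omega> in N. Q \<omega>"
  shows "AE \<omega> in M. Q (left_shift \<omega>)"
proof -
  interpret path_prob_space M by (rule is_markov_measure_path_prob_space[OF M])
  have "left_shift \<in> M \<rightarrow>\<^sub>M path_space"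
    by (rule measurable_path[THEN iffD2, OF left_shift_measurable])
  moreover have "AE \<omega> in distr M path_space left_shift. Q \<omega>"
    by (rule AE[OF is_markov_measure_left_shift[OF M]])
  ultimately show ?thesis by (rule AE_distrD)
qed

section \<open>Random products and the transfer operator\<close>

section \<open>Averages of bounded random products\<close>

text \<open>One constant serves the products over all words, whatever their length. A bound per
  factor would not do: its powers may grow, since the norm at hand need not make each
  \<open>T w\<close> a contraction.\<close>

locale markov_cocycle =
  fixes P :: "real^'w^('w::finite)" and T :: "'w \<Rightarrow> 'b \<Rightarrow> 'b::euclidean_space" and c :: real
  assumes stochastic: "right_stochastic P"
    and linear_T: "linear (T w)"
    and c_nonneg: "0 \<le> c"
    and bounded_products: "norm (foldr T ws x) \<le> c * norm x"
begin

definition transfer :: "('w \<Rightarrow> 'b) \<Rightarrow> 'w \<Rightarrow> 'b" where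
  "transfer X = (\<lambda>w. \<Sum>\<nu>\<in>UNIV. (P $ w $ \<nu>) *\<^sub>R T w (X \<nu>))"

text \<open>The factors start at coordinate 0; along \<open>left_shift \<omega>\<close> this becomes
  the product of the theorem, which starts at coordinate 1.\<close>

definition path_term :: "('w \<Rightarrow> 'b) \<Rightarrow> nat \<Rightarrow> (nat \<Rightarrow> 'w) \<Rightarrow> 'b" where
  "path_term X n \<omega> = foldr T (map \<omega> [0..<n]) (X (\<omega> n))"

definition path_average :: "('w \<Rightarrow> 'b) \<Rightarrow> nat \<Rightarrow> (nat \<Rightarrow> 'w) \<Rightarrow> 'b" where
  "path_average X N \<omega> = (1 / real N) *\<^sub>R (\<Sum>n<N. path_term X n \<omega>)"

definition total_norm :: "('w \<Rightarrow> 'b) \<Rightarrow> real" where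
  "total_norm X = (\<Sum>w\<in>UNIV. norm (X w))"

lemma linear_foldr: "linear (foldr T ws)"
proof (induction ws)
  case (Cons w ws)
  then show ?case
    using linear_compose[OF Cons linear_T[of w]] by (simp add: comp_def)
qed (simp add: linear_id[unfolded id_def])

lemma transfer_nonneg: "0 \<le> P $ w $ \<nu>" and transfer_sum: "(\<Sum>\<nu>\<in>UNIV. P $ w $ \<nu>) = 1"
  using stochastic by (simp_all add: right_stochastic_def prob_vector_def)

lemma path_term_0: "path_term X 0 \<omega> = X (\<omega> 0)"
  by (simp add: path_term_def)

lemma path_term_Suc: "path_term X (Suc n) \<omega> = T (\<omega> 0) (path_term X n (left_shift \<omega>))"
proof -
  have "map \<omega> [0..<Suc n] = \<omega> 0 # map (left_shift \<omega>) [0..<n]"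
    by (simp add: map_upt_Suc left_shift_def[abs_def] del: upt_Suc)
  then show ?thesis by (simp add: path_term_def left_shift_def)
qed

lemma prefix_foldr: "prefix_fun n (\<lambda>\<omega>. foldr T (map \<omega> [0..<n]) x)"
proof (rule prefix_funI)
  fix \<omega> \<omega>' :: "nat \<Rightarrow> 'w" assume "\<And>i. i < n \<Longrightarrow> \<omega> i = \<omega>' i"
  then have "map \<omega> [0..<n] = map \<omega>' [0..<n]" by simp
  then show "foldr T (map \<omega> [0..<n]) x = foldr T (map \<omega>' [0..<n]) x" by (rule arg_cong)
qed

lemma prefix_path_term: "prefix_fun (Suc n) (path_term X n)"
proof (rule prefix_funI)
  fix \<omega> \<omega>' :: "nat \<Rightarrow> 'w" assume "\<And>i. i < Suc n \<Longrightarrow> \<omega> i = \<omega>' i"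
  then have "map \<omega> [0..<n] = map \<omega>' [0..<n]" "\<omega> n = \<omega>' n" by simp_all
  then show "path_term X n \<omega> = path_term X n \<omega>'" by (simp only: path_term_def)
qed

lemma prefix_path_average: "prefix_fun N (path_average X N)"
  unfolding path_average_def[abs_def]
  by (rule prefix_fun_comp, rule prefix_fun_sum, rule prefix_fun_mono[OF prefix_path_term]) simp

lemma norm_path_term_le: "norm (path_term X n \<omega>) \<le> c * total_norm X"
proof -
  have "norm (path_term X n \<omega>) \<le> c * norm (X (\<omega> n))"
    unfolding path_term_def by (rule bounded_products)
  also have "\<dots> \<le> c * total_norm X"
    unfolding total_norm_def by (intro mult_left_mono c_nonneg member_le_sum) auto
  finally show ?thesis .
qed

lemma total_norm_nonneg: "0 \<le> total_norm X"
  by (simp add: total_norm_def sum_nonneg)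

lemma norm_path_average_le: "norm (path_average X N \<omega>) \<le> c * total_norm X"
proof (cases "N = 0")
  case False
  have "norm (\<Sum>n<N. path_term X n \<omega>) \<le> real (card {..<N}) * (c * total_norm X)"
    by (intro order_trans[OF norm_sum] sum_bounded_above norm_path_term_le)
  then show ?thesis
    using False by (simp add: path_average_def field_simps)
qed (simp add: path_average_def c_nonneg total_norm_nonneg)

text \<open>Iterating \<open>transfer\<close> averages products of \<open>T\<close> with the
  transition probabilities as weights. The induction carries an arbitrary word \<open>ws\<close> in
  front, so that the product bound is used once, at the innermost level, and \<open>c\<close> does
  not compound.\<close>

lemma transfer_funpow_bounded: "norm ((transfer ^^ n) X w) \<le> c * total_norm X"
proof -
  have "norm (foldr T ws ((transfer ^^ n) X w)) \<le> c * total_norm X" for ws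
  proof (induction n arbitrary: ws w)
    case 0
    have "norm (foldr T ws (X w)) \<le> c * norm (X w)" by (rule bounded_products)
    also have "\<dots> \<le> c * total_norm X"
      unfolding total_norm_def by (intro mult_left_mono c_nonneg member_le_sum) auto
    finally show ?case by simp
  next
    case (Suc n)
    let ?Y = "(transfer ^^ n) X"
    have "foldr T ws ((transfer ^^ Suc n) X w) = (\<Sum>\<nu>\<in>UNIV. P $ w $ \<nu> *\<^sub>R foldr T (ws @ [w]) (?Y \<nu>))"
      by (simp add: transfer_def linear_sum[OF linear_foldr] linear_cmul[OF linear_foldr])
    also have "norm \<dots> \<le> (\<Sum>\<nu>\<in>UNIV. P $ w $ \<nu> * (c * total_norm X))"
      by (rule sum_norm_le) (use Suc transfer_nonneg in \<open>simp only: norm_scaleR abs_of_nonneg mult_left_mono\<close>)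
    also have "\<dots> = c * total_norm X"
      by (simp add: transfer_sum flip: sum_distrib_right)
    finally show ?case .
  qed
  from this[of "[]"] show ?thesis by simp
qed

text \<open>Functions on the states are repackaged as vectors in \<open>'b^'w\<close>, a Euclidean
  space on which \<open>fixed_plus_coboundary\<close> applies.\<close>

lemma transfer_decomposition:
  obtains Y Z where "transfer Y = Y" "\<And>w. X w = Y w + (Z w - transfer Z w)"
proof -
  define f where "f V = (\<chi> w. transfer (\<lambda>\<nu>. V $ \<nu>) w)" for V :: "'b^'w"
  have "linear f"
    by (rule linearI) (simp_all add: f_def transfer_def vec_eq_iff linear_add[OF linear_T]
        linear_cmul[OF linear_T] scaleR_add_right sum.distrib scaleR_sum_right mult.commute)
  moreover have "Bseq (\<lambda>n. (f ^^ n) V)" for V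
  proof (rule BseqI')
    fix n
    have iter: "(f ^^ n) V $ w = (transfer ^^ n) (\<lambda>\<nu>. V $ \<nu>) w" for w
      by (induction n arbitrary: w) (simp_all add: f_def)
    have "norm ((f ^^ n) V) \<le> (\<Sum>w\<in>UNIV. norm ((f ^^ n) V $ w))"
      unfolding norm_vec_def by (rule L2_set_le_sum) simp
    also have "\<dots> \<le> (\<Sum>w\<in>(UNIV::'w set). c * total_norm (\<lambda>\<nu>. V $ \<nu>))"
      unfolding iter by (rule sum_mono) (rule transfer_funpow_bounded)
    finally show "norm ((f ^^ n) V) \<le> (\<Sum>w\<in>(UNIV::'w set). c * total_norm (\<lambda>\<nu>. V $ \<nu>))" .
  qed
  ultimately obtain y z where yz: "f y = y" "(\<chi> w. X w) = y + (z - f z)"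
    by (rule fixed_plus_coboundary)
  show thesis
  proof
    show "transfer (\<lambda>w. y $ w) = (\<lambda>w. y $ w)"
    proof
      fix w show "transfer (\<lambda>w. y $ w) w = y $ w"
        using arg_cong[OF yz(1), of "\<lambda>V. V $ w"] by (simp add: f_def)
    qed
    show "X w = y $ w + (z $ w - transfer (\<lambda>w. z $ w) w)" for w
      using arg_cong[OF yz(2), of "\<lambda>V. V $ w"] by (simp add: f_def)
  qed
qed

section \<open>Innovations and almost sure convergence of the averages\<close>

text \<open>Given the coordinates up to \<open>n\<close>, only the state at time
  \<open>Suc n\<close> is random in \<open>path_term X (Suc n)\<close>. Averaging over it, and using
  linearity of the product, turns the last factor into \<open>transfer X\<close>.\<close>

lemma path_term_conditional_expectation:
  assumes M: "is_markov_measure p P M" and g: "prefix_fun (Suc n) g"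
  shows "(\<integral>\<omega>. g \<omega> \<bullet> path_term X (Suc n) \<omega> \<partial>M) = (\<integral>\<omega>. g \<omega> \<bullet> path_term (transfer X) n \<omega> \<partial>M)"
proof -
  interpret path_prob_space M by (rule is_markov_measure_path_prob_space[OF M])
  \<comment> \<open>Freezing the next state at \<open>v\<close> leaves a function of the first
    \<open>Suc n\<close> coordinates, as \<open>markov_property\<close> requires.\<close>
  define h where "h v \<omega> = g \<omega> \<bullet> foldr T (map \<omega> [0..<Suc n]) (X v)" for v \<omega>
  have h: "prefix_fun (Suc n) (h v)" for v
    unfolding h_def[abs_def] by (rule prefix_fun_comp2[OF g prefix_foldr])
  have int1: "integrable M (\<lambda>\<omega>. h v \<omega> * of_bool (\<omega> (Suc n) = v))" for v
    by (rule integrable_prefix_fun[where n = "Suc (Suc n)"],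
        rule prefix_fun_comp2[OF prefix_fun_mono[OF h] prefix_fun_component]) simp_all
  have int2: "integrable M (\<lambda>\<omega>. h v \<omega> * P $ \<omega> n $ v)" for v
    by (rule integrable_prefix_fun[where n = "Suc n"],
        rule prefix_fun_comp2[OF h prefix_fun_component]) simp_all
  have next_term: "g \<omega> \<bullet> path_term X (Suc n) \<omega> = (\<Sum>v\<in>UNIV. h v \<omega> * of_bool (\<omega> (Suc n) = v))" for \<omega>
    by (simp add: h_def path_term_def of_bool_def if_distrib[of "\<lambda>x. _ * x"] cong: if_cong del: upt_Suc)
  have averaged: "g \<omega> \<bullet> path_term (transfer X) n \<omega> = (\<Sum>v\<in>UNIV. h v \<omega> * P $ \<omega> n $ v)" for \<omega>
    by (simp add: h_def path_term_def transfer_def linear_sum[OF linear_foldr]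
        linear_cmul[OF linear_foldr] inner_sum_right mult.commute)
  show ?thesis
    unfolding next_term averaged
    by (simp only: Bochner_Integration.integral_sum[OF int1] Bochner_Integration.integral_sum[OF int2]
        markov_property[OF M h])
qed

text \<open>The path term minus its conditional expectation given the preceding coordinates. At
  \<open>n = 0\<close> the value 0 is chosen because orthogonality against constants demands mean
  zero.\<close>

definition innovation :: "('w \<Rightarrow> 'b) \<Rightarrow> nat \<Rightarrow> (nat \<Rightarrow> 'w) \<Rightarrow> 'b" where
  "innovation X n \<omega> = (case n of 0 \<Rightarrow> 0 | Suc m \<Rightarrow> path_term X n \<omega> - path_term (transfer X) m \<omega>)"

lemma innovation_martingale_diff:
  assumes M: "is_markov_measure p P M"
  shows "path_martingale_diff M (innovation X)"
proof -
  interpret path_prob_space M by (rule is_markov_measure_path_prob_space[OF M])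
  show ?thesis
  proof
    fix n
    show "prefix_fun (Suc n) (innovation X n)"
    proof (cases n)
      case (Suc m)
      show ?thesis
        unfolding Suc innovation_def[abs_def] nat.case
        by (intro prefix_fun_comp2[where h = minus] prefix_path_term prefix_fun_mono[OF prefix_path_term]) simp
    qed (simp add: innovation_def[abs_def] prefix_fun_const)
    fix g :: "(nat \<Rightarrow> 'w) \<Rightarrow> 'b" assume g: "prefix_fun n g"
    show "(\<integral>\<omega>. g \<omega> \<bullet> innovation X n \<omega> \<partial>M) = 0"
    proof (cases n)
      case (Suc m)
      have g': "prefix_fun (Suc m) g" using g Suc by simp
      have "integrable M (\<lambda>\<omega>. g \<omega> \<bullet> path_term X (Suc m) \<omega>)"
        by (rule integrable_prefix_fun[OF prefix_fun_comp2[OF prefix_fun_mono[OF g'] prefix_path_term]]) simp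
      moreover have "integrable M (\<lambda>\<omega>. g \<omega> \<bullet> path_term (transfer X) m \<omega>)"
        by (rule integrable_prefix_fun[OF prefix_fun_comp2[OF g' prefix_path_term]])
      ultimately show ?thesis
        using path_term_conditional_expectation[OF M g', of X]
        by (simp add: Suc innovation_def inner_diff_right)
    qed (simp add: innovation_def)
  qed
qed

lemma norm_innovation_le: "norm (innovation X n \<omega>) \<le> c * total_norm X + c * total_norm (transfer X)"
proof (cases n)
  case (Suc m)
  have "norm (innovation X n \<omega>) \<le> norm (path_term X n \<omega>) + norm (path_term (transfer X) m \<omega>)"
    by (simp add: Suc innovation_def norm_triangle_ineq4)
  then show ?thesis
    using norm_path_term_le[of X n \<omega>] norm_path_term_le[of "transfer X" m \<omega>] by linarith
qed (simp add: innovation_def c_nonneg total_norm_nonneg)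

text \<open>For a fixed point the predictor of each path term is the preceding path term, so the
  innovations telescope to a bounded martingale.\<close>

lemma AE_path_term_fixed:
  assumes M: "is_markov_measure p P M" and Y: "transfer Y = Y"
  shows "AE \<omega> in M. convergent (\<lambda>n. path_term Y n \<omega>)"
proof -
  interpret path_martingale_diff M "innovation Y" by (rule innovation_martingale_diff[OF M])
  have sum: "(\<Sum>i<Suc n. innovation Y i \<omega>) = path_term Y n \<omega> - path_term Y 0 \<omega>" for n \<omega>
    by (induction n) (simp_all add: innovation_def Y)
  have "norm (\<Sum>i<n. innovation Y i \<omega>) \<le> 2 * (c * total_norm Y)" for n \<omega>
  proof (cases n)
    case (Suc m)
    show ?thesis
      unfolding Suc sum
      using norm_triangle_ineq4[of "path_term Y m \<omega>" "path_term Y 0 \<omega>"]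
        norm_path_term_le[of Y m \<omega>] norm_path_term_le[of Y 0 \<omega>] by linarith
  qed (simp add: c_nonneg total_norm_nonneg)
  then have "AE \<omega> in M. summable (\<lambda>i. innovation Y i \<omega>)" by (rule AE_summable_bounded)
  then show ?thesis
  proof (rule eventually_mono)
    fix \<omega> assume "summable (\<lambda>i. innovation Y i \<omega>)"
    then have "convergent (\<lambda>n. \<Sum>i<Suc n. innovation Y i \<omega>)"
      unfolding summable_iff_convergent by (rule convergent_Suc_iff[THEN iffD2])
    then obtain l where "(\<lambda>n. path_term Y n \<omega> - path_term Y 0 \<omega>) \<longlonglongrightarrow> l"
      unfolding sum convergent_def by blast
    from tendsto_add[OF this tendsto_const[of "path_term Y 0 \<omega>"]]
    show "convergent (\<lambda>n. path_term Y n \<omega>)" by (auto simp: convergent_def)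
  qed
qed

text \<open>Pairing term \<open>n\<close> of \<open>Z\<close> with term \<open>n - 1\<close> of
  \<open>transfer Z\<close>, instead of term \<open>n\<close>, turns the sum into innovations plus
  two bounded boundary terms. The strong law handles the former, and division by the length kills
  the latter.\<close>

lemma AE_path_average_coboundary:
  assumes M: "is_markov_measure p P M"
  shows "AE \<omega> in M. (\<lambda>N. path_average (\<lambda>w. Z w - transfer Z w) N \<omega>) \<longlonglongrightarrow> 0"
proof -
  interpret path_martingale_diff M "innovation Z" by (rule innovation_martingale_diff[OF M])
  have diff: "path_term (\<lambda>w. Z w - transfer Z w) n \<omega> = path_term Z n \<omega> - path_term (transfer Z) n \<omega>" for n \<omega>
    by (simp add: path_term_def linear_diff[OF linear_foldr])
  have telescope: "(\<Sum>n<Suc N. path_term (\<lambda>w. Z w - transfer Z w) n \<omega>)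
      = path_term Z 0 \<omega> + (\<Sum>n<Suc N. innovation Z n \<omega>) - path_term (transfer Z) N \<omega>" for N \<omega>
    by (induction N) (simp_all add: diff innovation_def)
  have "AE \<omega> in M. (\<lambda>N. (1 / real N) *\<^sub>R (\<Sum>n<N. innovation Z n \<omega>)) \<longlonglongrightarrow> 0"
    by (rule AE_strong_law) (rule norm_innovation_le)
  then show ?thesis
  proof (rule eventually_mono)
    fix \<omega> assume lim: "(\<lambda>N. (1 / real N) *\<^sub>R (\<Sum>n<N. innovation Z n \<omega>)) \<longlonglongrightarrow> 0"
    define r where "r N = path_term Z 0 \<omega> - path_term (transfer Z) N \<omega>" for N
    have "(\<lambda>N. (1 / real (Suc N)) *\<^sub>R r N) \<longlonglongrightarrow> 0"
    proof (rule tendsto_0_le[where K = 1])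
      show "(\<lambda>N. (1 / real (Suc N)) *\<^sub>R (c * total_norm Z + c * total_norm (transfer Z))) \<longlonglongrightarrow> 0"
        using tendsto_mult_left_zero[OF LIMSEQ_Suc[OF lim_1_over_n]] by (simp del: of_nat_Suc)
      have "norm (r N) \<le> c * total_norm Z + c * total_norm (transfer Z)" for N
        unfolding r_def
        using norm_triangle_ineq4[of "path_term Z 0 \<omega>" "path_term (transfer Z) N \<omega>"]
          norm_path_term_le[of Z 0 \<omega>] norm_path_term_le[of "transfer Z" N \<omega>] by linarith
      then show "\<forall>\<^sub>F N in sequentially. norm ((1 / real (Suc N)) *\<^sub>R r N)
          \<le> norm ((1 / real (Suc N)) *\<^sub>R (c * total_norm Z + c * total_norm (transfer Z))) * 1"
        by (intro always_eventually allI) (simp add: divide_right_mono c_nonneg total_norm_nonneg)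
    qed
    from tendsto_add[OF LIMSEQ_Suc[OF lim] this]
    have "(\<lambda>N. path_average (\<lambda>w. Z w - transfer Z w) (Suc N) \<omega>) \<longlonglongrightarrow> 0"
      unfolding path_average_def telescope r_def by (simp only: add_0 flip: scaleR_add_right)
        (simp only: add_ac diff_conv_add_uminus)
    then show "(\<lambda>N. path_average (\<lambda>w. Z w - transfer Z w) N \<omega>) \<longlonglongrightarrow> 0"
      by (rule LIMSEQ_imp_Suc)
  qed
qed

theorem AE_convergent_path_average:
  assumes M: "is_markov_measure p P M"
  shows "AE \<omega> in M. convergent (\<lambda>N. path_average X N \<omega>)"
proof -
  obtain Y Z where Y: "transfer Y = Y" and X: "\<And>w. X w = Y w + (Z w - transfer Z w)"
    using transfer_decomposition[of X] by blast
  have split: "path_average X N \<omega> = path_average Y N \<omega> + path_average (\<lambda>w. Z w - transfer Z w) N \<omega>" for N \<omega>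
    unfolding path_average_def path_term_def X
    by (simp add: linear_add[OF linear_foldr] sum.distrib scaleR_add_right)
  show ?thesis
    using AE_path_term_fixed[OF M Y] AE_path_average_coboundary[OF M, of Z]
  proof eventually_elim
    case (elim \<omega>)
    then obtain l where "(\<lambda>n. path_term Y n \<omega>) \<longlonglongrightarrow> l" by (auto simp: convergent_def)
    then have "(\<lambda>N. path_average Y N \<omega>) \<longlonglongrightarrow> l"
      unfolding path_average_def by (rule tendsto_cesaro)
    from tendsto_add[OF this elim(2)] show ?case
      unfolding split by (auto simp: convergent_def)
  qed
qed

section \<open>The limit function: measurability, equivariance and expectation\<close>

definition path_limit :: "('w \<Rightarrow> 'b) \<Rightarrow> (nat \<Rightarrow> 'w) \<Rightarrow> 'b" where
  "path_limit X \<omega> =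
     (if convergent (\<lambda>N. path_average X N \<omega>) then lim (\<lambda>N. path_average X N \<omega>) else 0)"

lemma path_limit_tendsto:
  "convergent (\<lambda>N. path_average X N \<omega>) \<Longrightarrow> (\<lambda>N. path_average X N \<omega>) \<longlonglongrightarrow> path_limit X \<omega>"
  by (simp add: path_limit_def convergent_LIMSEQ_iff)

lemma norm_path_limit_le: "norm (path_limit X \<omega>) \<le> c * total_norm X"
proof (cases "convergent (\<lambda>N. path_average X N \<omega>)")
  case True
  from tendsto_norm[OF path_limit_tendsto[OF this]] show ?thesis
    by (rule LIMSEQ_le_const2) (auto intro: norm_path_average_le)
qed (simp add: path_limit_def c_nonneg total_norm_nonneg)

lemma path_limit_measurable: "path_limit X \<in> borel_measurable path_space"
proof -
  \<comment> \<open>This measure only gives access to the results about path measures; measurability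
    depends on its sigma-algebra alone.\<close>
  obtain M :: "(nat \<Rightarrow> 'w) measure" where M: "is_markov_measure (axis undefined 1) P M"
    using is_markov_measure_exists[OF prob_vector_axis stochastic] by blast
  interpret path_prob_space M by (rule is_markov_measure_path_prob_space[OF M])
  have [measurable]: "path_average X N \<in> borel_measurable M" for N
    by (rule borel_measurable_prefix_fun[OF prefix_path_average])
  have "path_limit X \<in> borel_measurable M"
    \<comment> \<open>Convergence is rewritten as the Cauchy condition, which defines a measurable
      set of paths.\<close>
    unfolding path_limit_def[abs_def] Cauchy_convergent_iff[symmetric] by measurable
  then show ?thesis by (rule measurable_path[THEN iffD1])
qed

text \<open>Separating term 0 and the outermost factor expresses the average of length
  \<open>Suc N\<close> through that of length \<open>N\<close> along the shifted path, with weights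
  tending to 0 and 1. Convergence along \<omega> itself is thus a consequence.\<close>

lemma path_limit_shift:
  assumes "convergent (\<lambda>N. path_average X N (left_shift \<omega>))"
  shows "T (\<omega> 0) (path_limit X (left_shift \<omega>)) = path_limit X \<omega>"
proof -
  let ?l = "T (\<omega> 0) (path_limit X (left_shift \<omega>))"
  have bl: "bounded_linear (T w)" for w
    using linear_T by (simp add: linear_conv_bounded_linear)
  have "path_average X (Suc N) \<omega> = (1 / real (Suc N)) *\<^sub>R X (\<omega> 0)
      + (real N / real (Suc N)) *\<^sub>R T (\<omega> 0) (path_average X N (left_shift \<omega>))" for N
  proof -
    have "(\<Sum>n<Suc N. path_term X n \<omega>) = X (\<omega> 0) + (\<Sum>n<N. T (\<omega> 0) (path_term X n (left_shift \<omega>)))"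
      by (subst sum.lessThan_Suc_shift) (simp add: path_term_0 path_term_Suc)
    then show ?thesis
      by (cases "N = 0") (simp_all add: path_average_def scaleR_add_right linear_cmul[OF linear_T] linear_sum[OF linear_T]
          del: sum.lessThan_Suc of_nat_Suc)
  qed
  moreover have "(\<lambda>N. (1 / real (Suc N)) *\<^sub>R X (\<omega> 0)
      + (real N / real (Suc N)) *\<^sub>R T (\<omega> 0) (path_average X N (left_shift \<omega>))) \<longlonglongrightarrow> 0 *\<^sub>R X (\<omega> 0) + 1 *\<^sub>R ?l"
    by (intro tendsto_add tendsto_scaleR tendsto_const LIMSEQ_n_over_Suc_n LIMSEQ_Suc[OF lim_1_over_n]
        bounded_linear.tendsto[OF bl] path_limit_tendsto assms)
  ultimately have "(\<lambda>N. path_average X (Suc N) \<omega>) \<longlonglongrightarrow> ?l" by simp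
  then have "(\<lambda>N. path_average X N \<omega>) \<longlonglongrightarrow> ?l" by (rule LIMSEQ_imp_Suc)
  then show ?thesis
    using LIMSEQ_unique path_limit_tendsto by (metis convergentI)
qed

text \<open>Conditioning against constant test functions trades one time step for one application of
  \<open>transfer\<close>; at time 0 the chain sits at \<open>w\<close> almost surely.\<close>

lemma expectation_path_term:
  assumes M: "is_markov_measure (axis w 1) P M"
  shows "(\<integral>\<omega>. path_term X n \<omega> \<partial>M) = (transfer ^^ n) X w"
proof -
  interpret path_prob_space M by (rule is_markov_measure_path_prob_space[OF M])
  have int: "integrable M (path_term X n)" for X n
    by (rule integrable_prefix_fun[OF prefix_path_term])
  show ?thesis
  proof (induction n arbitrary: X)
    case 0
    have "prob {\<omega>. \<omega> 0 = w} = 1"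
      using markov_cylinder[OF M, of 0 "\<lambda>_. w"] by (simp add: axis_def)
    moreover have "{\<omega>. \<omega> 0 = w} \<in> events"
      using cylinder_measurable[of 1 "\<lambda>_. w"] by simp
    ultimately have "AE \<omega> in M. \<omega> 0 = w"
      using AE_in_set_eq_1[of "{\<omega>. \<omega> 0 = w}"] by simp
    then have "(\<integral>\<omega>. path_term X 0 \<omega> \<partial>M) = (\<integral>\<omega>. X w \<partial>M)"
      by (intro integral_cong_AE[OF borel_measurable_integrable[OF int]])
        (auto simp: path_term_0 elim: eventually_mono)
    then show ?case by (simp add: prob_space)
  next
    case (Suc n)
    have "(\<integral>\<omega>. path_term X (Suc n) \<omega> \<partial>M) = (\<integral>\<omega>. path_term (transfer X) n \<omega> \<partial>M)"
    proof (subst vector_eq_ldot[symmetric], rule allI)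
      fix x :: 'b
      show "x \<bullet> (\<integral>\<omega>. path_term X (Suc n) \<omega> \<partial>M) = x \<bullet> (\<integral>\<omega>. path_term (transfer X) n \<omega> \<partial>M)"
        using path_term_conditional_expectation[OF M prefix_fun_const, of x X n] int by simp
    qed
    then show ?case by (simp add: Suc funpow_swap1)
  qed
qed

text \<open>By dominated convergence the expected limit is the limit of the Cesaro means
  \<open>E N\<close> of the powers of \<open>transfer\<close>. Applying \<open>transfer\<close>
  changes \<open>E N\<close> by a bounded difference divided by \<open>N\<close>, so the limit is
  fixed.\<close>

theorem transfer_expectation_path_limit:
  assumes M: "\<And>w. is_markov_measure (axis w 1) P (M w)"
  shows "transfer (\<lambda>w. \<integral>\<omega>. path_limit X \<omega> \<partial>M w) = (\<lambda>w. \<integral>\<omega>. path_limit X \<omega> \<partial>M w)"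
proof
  fix w
  define E where "E N w = (1 / real N) *\<^sub>R (\<Sum>n<N. (transfer ^^ n) X w)" for N w
  have E: "(\<lambda>N. E N w) \<longlonglongrightarrow> (\<integral>\<omega>. path_limit X \<omega> \<partial>M w)" for w
  proof -
    interpret path_prob_space "M w" by (rule is_markov_measure_path_prob_space[OF M])
    have "(\<lambda>N. \<integral>\<omega>. path_average X N \<omega> \<partial>M w) \<longlonglongrightarrow> (\<integral>\<omega>. path_limit X \<omega> \<partial>M w)"
    proof (rule integral_dominated_convergence[where w = "\<lambda>_. c * total_norm X"])
      show "path_limit X \<in> borel_measurable (M w)"
        by (rule measurable_path[THEN iffD2, OF path_limit_measurable])
      show "AE \<omega> in M w. (\<lambda>N. path_average X N \<omega>) \<longlonglongrightarrow> path_limit X \<omega>"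
        using AE_convergent_path_average[OF M] by (rule eventually_mono) (rule path_limit_tendsto)
    qed (auto intro: borel_measurable_prefix_fun[OF prefix_path_average] norm_path_average_le)
    moreover have "(\<integral>\<omega>. path_average X N \<omega> \<partial>M w) = E N w" for N
      unfolding path_average_def E_def
      using integrable_prefix_fun[OF prefix_path_term]
      by (simp add: Bochner_Integration.integral_sum expectation_path_term[OF M])
    ultimately show ?thesis by simp
  qed
  have bl: "bounded_linear (T w)"
    using linear_T by (simp add: linear_conv_bounded_linear)
  have "(\<lambda>N. transfer (E N) w) \<longlonglongrightarrow> transfer (\<lambda>w. \<integral>\<omega>. path_limit X \<omega> \<partial>M w) w"
    unfolding transfer_def by (intro tendsto_intros bounded_linear.tendsto[OF bl] E)
  moreover have "(\<lambda>N. transfer (E N) w) \<longlonglongrightarrow> (\<integral>\<omega>. path_limit X \<omega> \<partial>M w)"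
  proof -
    have step: "transfer (E N) w = E N w + (1 / real N) *\<^sub>R ((transfer ^^ N) X w - X w)" for N
    proof -
      have "transfer (E N) w = (1 / real N) *\<^sub>R (\<Sum>n<N. (transfer ^^ Suc n) X w)"
        by (simp add: E_def transfer_def linear_cmul[OF linear_T] linear_sum[OF linear_T]
            scaleR_sum_right sum.swap[of _ UNIV] mult_ac)
      also have "(\<Sum>n<N. (transfer ^^ Suc n) X w) = (\<Sum>n<N. (transfer ^^ n) X w) + ((transfer ^^ N) X w - X w)"
        by (induction N) simp_all
      also have "(1 / real N) *\<^sub>R \<dots> = E N w + (1 / real N) *\<^sub>R ((transfer ^^ N) X w - X w)"
        by (simp add: E_def scaleR_add_right)
      finally show ?thesis .
    qed
    have "(\<lambda>N. (1 / real N) *\<^sub>R ((transfer ^^ N) X w - X w)) \<longlonglongrightarrow> 0"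
    proof (rule lim_null_scaleR_bounded[OF lim_1_over_n, where B = "c * total_norm X + norm (X w)"])
      show "\<forall>\<^sub>F N in sequentially. 1 / real N = 0 \<or> norm ((transfer ^^ N) X w - X w) \<le> c * total_norm X + norm (X w)"
      proof (intro always_eventually allI disjI2)
        fix N
        show "norm ((transfer ^^ N) X w - X w) \<le> c * total_norm X + norm (X w)"
          using norm_triangle_ineq4[of "(transfer ^^ N) X w" "X w"] transfer_funpow_bounded[of N X w]
          by linarith
      qed
    qed
    from tendsto_add[OF E[of w] this] show ?thesis unfolding step by simp
  qed
  ultimately show "transfer (\<lambda>w. \<integral>\<omega>. path_limit X \<omega> \<partial>M w) w = (\<integral>\<omega>. path_limit X \<omega> \<partial>M w)"
    by (rule LIMSEQ_unique)
qed

end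

section \<open>Quadratic forms, positivity and a bound independent of the word length\<close>

section \<open>Bounds for products of adjoint channels\<close>

definition quad :: "('n::finite) op \<Rightarrow> complex^'n \<Rightarrow> complex" where
  "quad A u = cinner u (A *v u)"

text \<open>The rank-one operator of \<open>u\<close>, an unnormalised pure state; pairing with it
  evaluates a quadratic form.\<close>

definition dyad :: "complex^('n::finite) \<Rightarrow> 'n op" where
  "dyad u = (\<chi> i j. u $ i * cnj (u $ j))"

lemma hs_inner_dyad: "hs_inner (dyad u) A = quad A u"
  by (simp add: hs_inner_eq dyad_def quad_def cinner_def matrix_vector_mult_def sum_distrib_left
      mult_ac)

lemma quad_dyad: "quad (dyad u) v \<in> \<real>\<^sub>\<ge>\<^sub>0"
proof -
  have "quad (dyad u) v = cinner v u * cnj (cinner v u)"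
    unfolding cinner_def cnj_sum sum_product
    by (simp add: dyad_def quad_def cinner_def matrix_vector_mult_def sum_distrib_left mult_ac)
  then show ?thesis
    by (simp add: complex_mult_cnj nonneg_Reals_of_real_iff flip: of_real_add of_real_power)
qed

lemma trace_dyad: "trace (dyad u) = of_real (\<Sum>i\<in>UNIV. (cmod (u $ i))\<^sup>2)"
  by (simp add: trace_def dyad_def flip: complex_norm_square)

lemma cinner_axis: "cinner (axis j c) x = cnj c * x $ j"
proof -
  have "cnj (axis j c $ i) * x $ i = (if i = j then cnj c * x $ j else 0)" for i
    by (simp add: axis_def)
  then show ?thesis by (simp add: cinner_def)
qed

lemma matrix_vector_mult_axis: "(A *v axis j c) $ i = (A $ i $ j * c :: complex)"
proof -
  have "A $ i $ k * axis j c $ k = (if k = j then A $ i $ j * c else 0)" for k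
    by (simp add: axis_def)
  then show ?thesis by (simp add: matrix_vector_mult_def)
qed

lemma quad_axis_add:
  "quad A (axis i 1 + axis j c) = A$i$i + c * A$i$j + cnj c * A$j$i + c * cnj c * A$j$j"
proof -
  have "cinner (u + v) x = cinner u x + cinner v x" for u v x :: "complex^'a"
    by (simp add: cinner_def distrib_right sum.distrib)
  then show ?thesis
    by (simp add: quad_def cinner_axis matrix_vector_mult_axis matrix_vector_right_distrib algebra_simps)
qed

lemma polarization:
  "4 * A$i$j = quad A (axis i 1 + axis j 1) - quad A (axis i 1 + axis j (-1))
     - \<i> * quad A (axis i 1 + axis j \<i>) + \<i> * quad A (axis i 1 + axis j (-\<i>))"
  by (simp add: quad_axis_add algebra_simps)

text \<open>By polarization, four times an entry is a combination of four values of the form, with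
  coefficients of modulus one.\<close>

lemma cmod_entry_le:
  assumes "\<And>c. cmod c = 1 \<Longrightarrow> cmod (quad A (axis i 1 + axis j c)) \<le> r"
  shows "cmod (A$i$j) \<le> r"
proof -
  have tri: "cmod (a - b - \<i> * c + \<i> * d) \<le> cmod a + cmod b + cmod c + cmod d" for a b c d
    using norm_triangle_ineq[of "a - b - \<i> * c" "\<i> * d"] norm_triangle_ineq4[of "a - b" "\<i> * c"]
      norm_triangle_ineq4[of a b] by (simp add: norm_mult)
  have "4 * cmod (A$i$j) = cmod (4 * A$i$j)" by (simp add: norm_mult)
  also have "\<dots> \<le> r + r + r + r"
    unfolding polarization by (intro order_trans[OF tri] add_mono assms) simp_all
  finally show ?thesis by simp
qed

lemma norm_op_le:
  fixes A :: "('n::finite) op"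
  assumes "\<And>i j. cmod (A$i$j) \<le> r"
  shows "norm A \<le> (real CARD('n))\<^sup>2 * r"
proof -
  have "norm (A$i) \<le> (\<Sum>j\<in>UNIV. norm (A$i$j))" for i
    unfolding norm_vec_def[of "A$i"] by (rule L2_set_le_sum) simp
  also have "(\<Sum>j\<in>UNIV. norm (A$i$j)) \<le> real CARD('n) * r" for i
    using sum_bounded_above[of UNIV "\<lambda>j. norm (A$i$j)" r] assms by simp
  finally have row: "norm (A$i) \<le> real CARD('n) * r" for i .
  have "norm A \<le> (\<Sum>i\<in>UNIV. norm (A$i))"
    unfolding norm_vec_def[of A] by (rule L2_set_le_sum) simp
  also have "\<dots> \<le> real CARD('n) * (real CARD('n) * r)"
    using sum_bounded_above[of UNIV "\<lambda>i. norm (A$i)" "real CARD('n) * r"] row by simp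
  finally show ?thesis by (simp add: power2_eq_square)
qed

text \<open>Positivity lets the trace, which channels preserve, control the norm. The form values
  for \<open>c\<close> and \<open>-c\<close> are nonnegative and sum to twice two diagonal entries,
  hence each is at most four traces.\<close>

lemma norm_le_trace:
  fixes B :: "('n::finite) op"
  assumes B: "\<And>v. quad B v \<in> \<real>\<^sub>\<ge>\<^sub>0"
  shows "norm B \<le> (real CARD('n))\<^sup>2 * (4 * Re (trace B))"
proof (rule norm_op_le)
  fix i j
  have q: "0 \<le> Re (quad B v)" "cmod (quad B v) = Re (quad B v)" for v
    using B[of v] by (auto simp: complex_nonneg_Reals_iff cmod_eq_Re)
  have diag: "0 \<le> Re (B$k$k)" for k
  proof -
    have "quad B (axis k 1 + axis k 0) = B$k$k" by (simp add: quad_axis_add)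
    then show ?thesis using q by metis
  qed
  have entry: "Re (B$k$k) \<le> Re (trace B)" for k
    by (auto simp: trace_def intro!: member_le_sum[of k UNIV "\<lambda>k. Re (B$k$k)"] diag)
  show "cmod (B$i$j) \<le> 4 * Re (trace B)"
  proof (rule cmod_entry_le)
    fix c :: complex assume c: "cmod c = 1"
    have "c * cnj c = 1" using c by (simp add: complex_mult_cnj cmod_def)
    then have "quad B (axis i 1 + axis j c) + quad B (axis i 1 + axis j (-c)) = 2 * B$i$i + 2 * B$j$j"
      by (simp add: quad_axis_add)
    then have "Re (quad B (axis i 1 + axis j c)) + Re (quad B (axis i 1 + axis j (-c)))
        = 2 * Re (B$i$i) + 2 * Re (B$j$j)"
      by (simp add: complex_eq_iff)
    then show "cmod (quad B (axis i 1 + axis j c)) \<le> 4 * Re (trace B)"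
      using q(1)[of "axis i 1 + axis j (-c)"] q(2) entry[of i] entry[of j] by simp
  qed
qed

text \<open>The factor 2 comes from applying the real Cauchy-Schwarz inequality separately to the
  real and the imaginary part.\<close>

lemma cmod_hs_inner_le: "cmod (hs_inner A B) \<le> 2 * norm A * norm B"
proof -
  have "norm (cscale \<i> A) = norm A"
    by (simp add: cscale_def norm_vec_def map_matrix_def norm_mult)
  then have "\<bar>Im (hs_inner A B)\<bar> \<le> norm A * norm B"
    using Cauchy_Schwarz_ineq2[of "cscale \<i> A" B] by (simp add: Im_hs_inner)
  moreover have "\<bar>Re (hs_inner A B)\<bar> \<le> norm A * norm B"
    using Cauchy_Schwarz_ineq2[of A B] by (simp add: Re_hs_inner)
  ultimately show ?thesis
    using cmod_le[of "hs_inner A B"] by linarith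
qed

lemma cptp_clinear: "cptp \<Phi> \<Longrightarrow> clinear_map \<Phi>"
  by (simp add: cptp_def completely_positive_def)

text \<open>Complete positivity for a single block.\<close>

lemma cptp_positive:
  fixes \<Phi> :: "('a::finite) op \<Rightarrow> 'a op"
  assumes "cptp \<Phi>" and A: "\<And>v. quad A v \<in> \<real>\<^sub>\<ge>\<^sub>0"
  shows "quad (\<Phi> A) v \<in> \<real>\<^sub>\<ge>\<^sub>0"
proof -
  have "block_positive 1 (\<lambda>i j. A)"
    using A by (simp add: block_positive_def quad_def)
  moreover have "\<forall>k A. block_positive k A \<longrightarrow> block_positive k (\<lambda>i j. \<Phi> (A i j))"
    using assms(1) by (simp add: cptp_def completely_positive_def)
  ultimately have "block_positive 1 (\<lambda>i j. \<Phi> A)" by blast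
  then have "\<forall>v::nat \<Rightarrow> complex^'a. quad (\<Phi> A) (v 0) \<in> \<real>\<^sub>\<ge>\<^sub>0"
    by (simp add: block_positive_def quad_def)
  from this[rule_format, of "\<lambda>_. v"] show ?thesis .
qed

lemma linear_hs_adjoint:
  assumes "clinear_map \<Phi>"
  shows "linear (hs_adjoint \<Phi>)"
proof -
  have adj: "x \<bullet> hs_adjoint \<Phi> y = \<Phi> x \<bullet> y" for x y
    using hs_inner_adjoint[OF assms] by (metis Re_hs_inner)
  show ?thesis
  proof (rule linearI)
    fix x y show "hs_adjoint \<Phi> (x + y) = hs_adjoint \<Phi> x + hs_adjoint \<Phi> y"
      by (subst vector_eq_ldot[symmetric]) (simp add: adj inner_add_right)
  next
    fix r x show "hs_adjoint \<Phi> (r *\<^sub>R x) = r *\<^sub>R hs_adjoint \<Phi> x"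
      by (subst vector_eq_ldot[symmetric]) (simp add: adj)
  qed
qed

text \<open>By duality the word acts on \<open>dyad u\<close> through the channels, which keep it
  positive with unchanged trace, so its norm is bounded independently of \<open>ws\<close>. The
  constant collects \<open>CARD('n)\<^sup>2\<close> from entries to norm, 2 from Cauchy-Schwarz, and
  \<open>CARD('n)\<^sup>2 * 4 * 4\<close> from the trace bound.\<close>

lemma norm_foldr_hs_adjoint_le:
  fixes L :: "'w \<Rightarrow> ('n::finite) op \<Rightarrow> 'n op"
  assumes L: "\<And>w. cptp (L w)"
  shows "norm (foldr (\<lambda>w. hs_adjoint (L w)) ws A) \<le> 32 * real CARD('n) ^ 4 * norm A"
proof -
  \<comment> \<open>The outermost adjoint crosses the pairing first, so \<open>foldr\<close> turns
    into \<open>fold\<close>.\<close>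
  have dual: "hs_inner \<alpha> (foldr (\<lambda>w. hs_adjoint (L w)) ws A) = hs_inner (fold L ws \<alpha>) A" for \<alpha>
    by (induction ws arbitrary: \<alpha>) (simp_all add: hs_inner_adjoint[OF cptp_clinear[OF L], symmetric])
  have pos: "\<forall>v. quad (fold L ws B) v \<in> \<real>\<^sub>\<ge>\<^sub>0" if "\<forall>v. quad B v \<in> \<real>\<^sub>\<ge>\<^sub>0" for B
    using that
  proof (induction ws arbitrary: B)
    case (Cons w ws)
    then show ?case using cptp_positive[OF L] by (metis fold_simps(2))
  qed simp
  have tr: "trace (fold L ws B) = trace B" for B
    by (induction ws arbitrary: B) (use L in \<open>simp_all add: cptp_def\<close>)
  have "norm (foldr (\<lambda>w. hs_adjoint (L w)) ws A) \<le> (real CARD('n))\<^sup>2 * (32 * (real CARD('n))\<^sup>2 * norm A)"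
  proof (intro norm_op_le cmod_entry_le)
    fix i j :: 'n and c :: complex
    assume c: "cmod c = 1"
    define u :: "complex^'n" where "u = axis i 1 + axis j c"
    have "Re (trace (dyad u)) \<le> 4"
    proof -
      \<comment> \<open>The two summands also cover \<open>i = j\<close>, where the only nonzero
        coordinate is \<open>1 + c\<close>.\<close>
      have *: "(cmod (u $ k))\<^sup>2 \<le> (if k = i then 2 else 0) + (if k = j then 2 else 0)" for k
      proof -
        have "(cmod (1 + c))\<^sup>2 \<le> 2\<^sup>2"
          using norm_triangle_ineq[of 1 c] c by (intro power_mono) auto
        then show ?thesis using c by (auto simp: u_def axis_def)
      qed
      have "Re (trace (dyad u)) \<le> (\<Sum>k\<in>UNIV. (if k = i then 2 else 0) + (if k = j then 2 else 0))"
        unfolding trace_dyad Re_complex_of_real by (rule sum_mono) (rule *)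
      also have "\<dots> = 4" by (simp add: sum.distrib)
      finally show ?thesis .
    qed
    then have "(real CARD('n))\<^sup>2 * (4 * Re (trace (fold L ws (dyad u)))) \<le> (real CARD('n))\<^sup>2 * (4 * 4)"
      by (intro mult_left_mono) (simp_all add: tr)
    moreover have "norm (fold L ws (dyad u)) \<le> (real CARD('n))\<^sup>2 * (4 * Re (trace (fold L ws (dyad u))))"
      using pos quad_dyad by (intro norm_le_trace) blast
    ultimately have "norm (fold L ws (dyad u)) \<le> (real CARD('n))\<^sup>2 * (4 * 4)"
      by (rule order_trans[rotated])
    then have *: "2 * norm (fold L ws (dyad u)) \<le> 32 * (real CARD('n))\<^sup>2" by simp
    have "cmod (quad (foldr (\<lambda>w. hs_adjoint (L w)) ws A) u) \<le> 2 * norm (fold L ws (dyad u)) * norm A"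
      unfolding hs_inner_dyad[symmetric] dual by (rule cmod_hs_inner_le)
    also have "\<dots> \<le> 32 * (real CARD('n))\<^sup>2 * norm A"
      by (rule mult_right_mono[OF * norm_ge_zero])
    finally show "cmod (quad (foldr (\<lambda>w. hs_adjoint (L w)) ws A) (axis i 1 + axis j c))
        \<le> 32 * (real CARD('n))\<^sup>2 * norm A"
      by (simp only: u_def)
  qed
  also have "\<dots> = 32 * real CARD('n) ^ 4 * norm A"
    by (simp add: mult_ac flip: power_add[of _ 2 2, simplified])
  finally show ?thesis .
qed

section \<open>Assembly along the shifted path\<close>

section \<open>The ergodic theorem\<close>

theorem theorem3p2:
  fixes \<pi> :: "real^('w::finite)"
    and P :: "real^'w^'w"
    and L :: "'w \<Rightarrow> complex^'n^('n::finite) \<Rightarrow> complex^'n^'n"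
    and X :: "'w \<Rightarrow> complex^'n^'n"
  assumes pi: "prob_vector \<pi>"
    and P: "right_stochastic P"
    and L: "\<And>w. cptp (L w)"
    and stat: "\<pi> v* P = \<pi> \<or> (\<exists>\<rho>. prob_vector \<rho> \<and> \<rho> v* P = \<rho> \<and> (\<forall>w. 0 < \<rho> $ w))"
  shows "(AE \<omega> in markov_measure \<pi> P. convergent (\<lambda>N. ergodic_average L X N \<omega>))
    \<and> (\<forall>N. integrable (markov_measure \<pi> P) (ergodic_average L X N))
    \<and> integrable (markov_measure \<pi> P) (Xbar L X)
    \<and> (\<lambda>N. \<integral>\<omega>. norm (ergodic_average L X N \<omega> - Xbar L X \<omega>) \<partial>markov_measure \<pi> P) \<longlonglongrightarrow> 0
    \<and> (AE \<omega> in markov_measure \<pi> P. hs_adjoint (L (\<omega> 1)) (Xbar L X (left_shift \<omega>)) = Xbar L X \<omega>)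
    \<and> markov_transfer_adjoint P L (Xbarbar P L X) = Xbarbar P L X"
proof -
  let ?M = "markov_measure \<pi> P"
  interpret cocycle: markov_cocycle P "\<lambda>w. hs_adjoint (L w)" "32 * real CARD('n) ^ 4"
  proof (rule markov_cocycle.intro[OF P])
    show "linear (hs_adjoint (L w))" for w
      by (rule linear_hs_adjoint[OF cptp_clinear[OF L]])
  qed (simp_all add: norm_foldr_hs_adjoint_le[OF L])
  have M: "is_markov_measure \<pi> P ?M"
    by (rule is_markov_measure_markov_measure[OF pi P])
  interpret path_prob_space ?M
    by (rule is_markov_measure_path_prob_space[OF M])
  \<comment> \<open>The factors of \<open>heisenberg_product\<close> start at \<omega> 1, those of
    \<open>path_term\<close> at coordinate 0; the shift reconciles them.\<close>
  have term_eq: "heisenberg_product L X n \<omega> = cocycle.path_term X n (left_shift \<omega>)" for n \<omega>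
  proof -
    have "map \<omega> [1..<Suc n] = map \<omega> (map Suc [0..<n])"
      by (simp only: map_Suc_upt One_nat_def)
    also have "\<dots> = map (left_shift \<omega>) [0..<n]"
      by (simp add: left_shift_def)
    finally have "map (left_shift \<omega>) [0..<n] = map \<omega> [1..<Suc n]" by (rule sym)
    moreover have "heisenberg_product L X n \<omega>
        = foldr (\<lambda>w. hs_adjoint (L w)) (map \<omega> [1..<Suc n]) (X (\<omega> (Suc n)))"
      by (simp only: heisenberg_product_def foldr_map comp_def)
    ultimately show ?thesis
      by (simp only: cocycle.path_term_def) (simp only: left_shift_def)
  qed
  have average: "ergodic_average L X N \<omega> = cocycle.path_average X N (left_shift \<omega>)" for N \<omega>
    by (simp add: ergodic_average_def cocycle.path_average_def term_eq)
  have limit: "Xbar L X \<omega> = cocycle.path_limit X (left_shift \<omega>)" for \<omega>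
    by (simp add: Xbar_def cocycle.path_limit_def average)
  have shift_meas: "left_shift \<in> ?M \<rightarrow>\<^sub>M path_space"
    by (rule measurable_path[THEN iffD2, OF left_shift_measurable])
  have conv: "AE \<omega> in ?M. convergent (\<lambda>N. ergodic_average L X N \<omega>)"
    unfolding average by (rule AE_left_shift[OF M cocycle.AE_convergent_path_average])
  \<comment> \<open>Two shifts: \<open>ergodic_average\<close> already ignores \<omega> 0, and here
    it is evaluated along the shifted path.\<close>
  have conv_shift: "AE \<omega> in ?M. convergent (\<lambda>N. ergodic_average L X N (left_shift \<omega>))"
    unfolding average
    by (rule AE_left_shift[OF M]) (rule AE_left_shift[OF _ cocycle.AE_convergent_path_average])
  have int_average: "integrable ?M (ergodic_average L X N)" for N
  proof -
    have "prefix_fun (Suc N) (\<lambda>\<omega>. cocycle.path_average X N (left_shift \<omega>))"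
      by (intro prefix_funI prefix_funD[OF cocycle.prefix_path_average]) (simp add: left_shift_def)
    then show ?thesis unfolding average[abs_def] by (rule integrable_prefix_fun)
  qed
  \<comment> \<open>This uniform bound supplies the integrable majorant for \<open>L\<^sup>1\<close>
    convergence.\<close>
  define b where "b = 32 * real CARD('n) ^ 4 * cocycle.total_norm X"
  have bound: "norm (ergodic_average L X N \<omega>) \<le> b" "norm (Xbar L X \<omega>) \<le> b" for N \<omega>
    unfolding average limit b_def
    by (rule cocycle.norm_path_average_le cocycle.norm_path_limit_le)+
  have meas_Xbar: "Xbar L X \<in> borel_measurable ?M"
    unfolding limit[abs_def]
    by (rule measurable_compose[OF shift_meas cocycle.path_limit_measurable])
  then have int_Xbar: "integrable ?M (Xbar L X)"
    by (rule integrable_const_bound[where B = b, rotated]) (simp add: bound)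
  have L1: "(\<lambda>N. \<integral>\<omega>. norm (ergodic_average L X N \<omega> - Xbar L X \<omega>) \<partial>?M) \<longlonglongrightarrow> 0"
  proof -
    have "(\<lambda>N. \<integral>\<omega>. norm (ergodic_average L X N \<omega> - Xbar L X \<omega>) \<partial>?M) \<longlonglongrightarrow> (\<integral>\<omega>. 0 \<partial>?M)"
    proof (rule integral_dominated_convergence[where w = "\<lambda>_. b + b"])
      show "AE \<omega> in ?M. (\<lambda>N. norm (ergodic_average L X N \<omega> - Xbar L X \<omega>)) \<longlonglongrightarrow> 0"
        using conv
      proof (rule eventually_mono)
        fix \<omega> assume "convergent (\<lambda>N. ergodic_average L X N \<omega>)"
        then have "(\<lambda>N. ergodic_average L X N \<omega>) \<longlonglongrightarrow> Xbar L X \<omega>"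
          unfolding average limit by (rule cocycle.path_limit_tendsto)
        then show "(\<lambda>N. norm (ergodic_average L X N \<omega> - Xbar L X \<omega>)) \<longlonglongrightarrow> 0"
          by (intro tendsto_norm_zero LIM_zero)
      qed
      show "(\<lambda>\<omega>. norm (ergodic_average L X N \<omega> - Xbar L X \<omega>)) \<in> borel_measurable ?M" for N
        by (intro borel_measurable_integrable integrable_norm
            Bochner_Integration.integrable_diff int_average int_Xbar)
      show "AE \<omega> in ?M. norm (norm (ergodic_average L X N \<omega> - Xbar L X \<omega>)) \<le> b + b" for N
        using order_trans[OF norm_triangle_ineq4 add_mono[OF bound]] by (intro AE_I2) simp
    qed simp_all
    then show ?thesis by simp
  qed
  \<comment> \<open>\<open>path_limit_shift\<close> is used at \<open>left_shift \<omega>\<close>,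
    whose coordinate 0 is \<omega> 1.\<close>
  have invariance: "AE \<omega> in ?M. hs_adjoint (L (\<omega> 1)) (Xbar L X (left_shift \<omega>)) = Xbar L X \<omega>"
    using conv_shift
  proof (rule eventually_mono)
    fix \<omega> assume "convergent (\<lambda>N. ergodic_average L X N (left_shift \<omega>))"
    then show "hs_adjoint (L (\<omega> 1)) (Xbar L X (left_shift \<omega>)) = Xbar L X \<omega>"
      unfolding average limit using cocycle.path_limit_shift[of X "left_shift \<omega>"]
      by (simp add: left_shift_def)
  qed
  \<comment> \<open>The shift removes the filler put in front by \<open>case_nat\<close>, leaving
    the chain started at \<open>w\<close>.\<close>
  have "Xbarbar P L X = (\<lambda>w. \<integral>\<xi>. cocycle.path_limit X \<xi> \<partial>markov_measure (axis w 1) P)"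
    by (simp add: Xbarbar_def[abs_def] limit left_shift_def)
  moreover have "markov_transfer_adjoint P L = cocycle.transfer"
    by (simp add: markov_transfer_adjoint_def[abs_def] cocycle.transfer_def[abs_def])
  ultimately have "markov_transfer_adjoint P L (Xbarbar P L X) = Xbarbar P L X"
    using cocycle.transfer_expectation_path_limit[of "\<lambda>w. markov_measure (axis w 1) P" X]
      is_markov_measure_markov_measure[OF prob_vector_axis P] by simp
  then show ?thesis
    using conv int_average int_Xbar L1 invariance by blast
qed

end
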